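(* Let $P$ be a polynomial of degree $N$ that does not vanish at the zeros of $AS$, where $S=\mathfrak D_w[P]$ is its electrostatic partner. Then the discrete zero-counting measure $\nu(P)$ of $P$ is $\varphi$-critical for the external field $$\varphi(z)=\frac12\log\left|\frac{S}{v}\right|(z).$$
   Context: Semiclassical weight. $A$ is a monic polynomial with set of zeros $\mathbb A\subset\mathbb C$ (possibly empty), and $B$ is a polynomial (not assumed coprime to $A$). $\Delta=\Gamma_1\cup\dots\cup\Gamma_k$, where each $\Gamma_j$ is an oriented Jordan piecewise analytic arc joining a pair of points of $\mathbb A\cup\{\infty\}$ and containing no other point of $\mathbb A$ in its interior; the interiors of the $\Gamma_j$ are pairwise disjoint. Up to a normalization constant, define the (multivalued) analytic functions $$w(z)=\exp\left(\int^z\frac{B(t)}{A(t)}\,dt\right),\qquad v(z)=A(z)w(z),$$ with only possible singularities at $\mathbb A\cup\{\infty\}$, so that $w'/w=B/A$. The weight on $\Delta$, denoted by the same letter $w$, coincides on each $\Gamma_j$, up to a non-zero multiplicative constant, with the left boundary value $w_+$. It is assumed that $\int_\Delta|z|^m|w(z)||dz|<+\infty$ for $m=0,1,2,\dots$; as a consequence, $z^mv(z)=0$ (in the limit sense) at every endpoint of a subarc of $\Delta$, for all $m=0,1,2,\dots$. It is assumed that $\sigma=\max\{\deg(A)-2,\deg(B)-1\}\ge0$. Cauchy transform: $\mathfrak C_w[f](z)=\int_\Delta\frac{f(t)w(t)}{t-z}\,dt$. The electrostatic partner of a polynomial $P\not\equiv0$ is the function $$S=\mathfrak D_w[P]:=\det\begin{pmatrix}P&\mathfrak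 C_w[P]\\ AP'&A(\mathfrak C_w[P])'-B\,\mathfrak C_w[P]\end{pmatrix},$$ which is a polynomial. The zero-counting measure of a polynomial $y$ with zeros $\zeta_1,\dots,\zeta_N$ is $\nu(y)=\sum_{j}\delta_{\zeta_j}$. Critical measures: for an external field $\varphi=\Re\Phi$, with $\Phi$ analytic (possibly multivalued) in $\mathbb C$ outside a finite set of singularities/branch points and with single-valued derivative $\Phi'$, and pairwise distinct points $\zeta_1,\dots,\zeta_N$, the weighted discrete energy of $\mu=\sum_k\delta_{\zeta_k}$ is $$\mathcal E_\varphi(\zeta_1,\dots,\zeta_N)=\sum_{i\ne j}\log\frac1{|\zeta_i-\zeta_j|}+2\sum_{k=1}^N\varphi(\zeta_k).$$ $\mu$ is called $\varphi$-critical if its support is disjoint from the set of singularities of $\varphi$ and $\nabla\mathcal E_\varphi(\zeta_1,\dots,\zeta_N)=0$; explicitly, $\sum_{i\ne j}\frac1{\zeta_j-\zeta_i}-\Phi'(\zeta_j)=0$ for $j=1,\dots,N$. (Being $\varphi$-critical includes that the points $\zeta_j$ are pairwise distinct.) Here $\Phi'=\frac12\left(\frac{S'}{S}-\frac{A'}{A}-\frac BA\right)$. *)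

theory Defs
  imports "HOL-Complex_Analysis.Complex_Analysis"
begin

section \<open>Arcs and semiclassical weights\<close>

text \<open>
  An arc is given by a parametrization of its interior over the open unit interval; the values of
  the parametrization at 0 and 1 are irrelevant, since an endpoint may be the point at infinity.
  Analyticity is required, away from finitely many break points, on closed subintervals, so both
  one-sided pieces at a break point extend analytically (and regularly) across it.
\<close>

definition jordan_piecewise_analytic_arc :: "(real \<Rightarrow> complex) \<Rightarrow> bool" where
  "jordan_piecewise_analytic_arc \<gamma> \<longleftrightarrow>
     continuous_on {0<..<1} \<gamma> \<and> inj_on \<gamma> {0<..<1} \<and>
     (\<exists>T. finite T \<and>
        (\<forall>a b. 0 < a \<and> a < b \<and> b < 1 \<and> T \<inter> {a<..<b} = {} \<longrightarrow>
           (\<exists>g. g analytic_on (complex_of_real ` {a..b}) \<and>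
                (\<forall>t\<in>{a..b}. \<gamma> t = g (complex_of_real t) \<and> deriv g (complex_of_real t) \<noteq> 0))))"

definition arc_interior :: "(real \<Rightarrow> complex) \<Rightarrow> complex set" where
  "arc_interior \<gamma> = \<gamma> ` {0<..<1}"

definition arc_trace :: "(real \<Rightarrow> complex) \<Rightarrow> complex set" where
  "arc_trace \<gamma> = arc_interior \<gamma> \<union> {a. (\<gamma> \<longlongrightarrow> a) (at_right 0) \<or> (\<gamma> \<longlongrightarrow> a) (at_left 1)}"

text \<open>The end of \<open>\<gamma>\<close> along the filter \<open>F\<close> is a point of \<open>Z \<union> {\<infinity>}\<close>.\<close>

definition ends_in :: "(real \<Rightarrow> complex) \<Rightarrow> real filter \<Rightarrow> complex set \<Rightarrow> bool" where
  "ends_in \<gamma> F Z \<longleftrightarrow> (\<exists>a\<in>Z. (\<gamma> \<longlongrightarrow> a) F) \<or> filterlim \<gamma> at_infinity F"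

abbreviation zeros :: "complex poly \<Rightarrow> complex set" where
  "zeros A \<equiv> {z. poly A z = 0}"

text \<open>
  \<open>W\<close> is on \<open>U\<close> a single-valued branch of the multivalued function \<open>exp (\<integral> B/A)\<close>; the normalization
  constant is the constant of integration in \<open>L\<close>.
\<close>

definition w_branch ::
  "complex poly \<Rightarrow> complex poly \<Rightarrow> complex set \<Rightarrow> (complex \<Rightarrow> complex) \<Rightarrow> bool" where
  "w_branch A B U W \<longleftrightarrow> open U \<and> U \<inter> zeros A = {} \<and>
     (\<exists>L. (\<forall>z\<in>U. (L has_field_derivative poly B z / poly A z) (at z)) \<and> (\<forall>z\<in>U. W z = exp (L z)))"

text \<open>
  The support is the union of the arcs \<open>\<Gamma> 0, \<dots>, \<Gamma> (k - 1)\<close>. Since the multivalued weight has no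
  singularity on the interior of an arc, its left boundary value there is the restriction of a
  branch that is analytic in a neighbourhood of the interior.
\<close>

definition semiclassical_weight ::
  "complex poly \<Rightarrow> complex poly \<Rightarrow> nat \<Rightarrow> (nat \<Rightarrow> real \<Rightarrow> complex) \<Rightarrow> (complex \<Rightarrow> complex) \<Rightarrow> bool" where
  "semiclassical_weight A B k \<Gamma> w \<longleftrightarrow>
     lead_coeff A = 1 \<and>
     max (int (degree A) - 2) (int (degree B) - 1) \<ge> 0 \<and>
     k \<ge> 1 \<and>
     (\<forall>j<k. jordan_piecewise_analytic_arc (\<Gamma> j) \<and>
            ends_in (\<Gamma> j) (at_right 0) (zeros A) \<and> ends_in (\<Gamma> j) (at_left 1) (zeros A) \<and>
            arc_interior (\<Gamma> j) \<inter> zeros A = {}) \<and>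
     (\<forall>i<k. \<forall>j<k. i \<noteq> j \<longrightarrow> arc_interior (\<Gamma> i) \<inter> arc_interior (\<Gamma> j) = {}) \<and>
     (\<forall>j<k. \<exists>U W c. w_branch A B U W \<and> arc_interior (\<Gamma> j) \<subseteq> U \<and> c \<noteq> 0 \<and>
                    (\<forall>z\<in>arc_interior (\<Gamma> j). w z = c * W z)) \<and>
     (\<forall>j<k. \<forall>m. (\<lambda>t. cmod (\<Gamma> j t) ^ m * cmod (w (\<Gamma> j t)) * cmod (vector_derivative (\<Gamma> j) (at t)))
                  integrable_on {0<..<1})"


section \<open>Electrostatic partner\<close>

definition cauchy_transform ::
  "nat \<Rightarrow> (nat \<Rightarrow> real \<Rightarrow> complex) \<Rightarrow> (complex \<Rightarrow> complex) \<Rightarrow> (complex \<Rightarrow> complex) \<Rightarrow> complex \<Rightarrow> complex" where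
  "cauchy_transform k \<Gamma> w f z = (\<Sum>j<k. contour_integral (\<Gamma> j) (\<lambda>t. f t * w t / (t - z)))"

text \<open>
  The determinant makes sense off the support only; the electrostatic partner is the polynomial
  that coincides with it there.
\<close>

definition partner_det ::
  "complex poly \<Rightarrow> complex poly \<Rightarrow> nat \<Rightarrow> (nat \<Rightarrow> real \<Rightarrow> complex) \<Rightarrow> (complex \<Rightarrow> complex) \<Rightarrow>
   complex poly \<Rightarrow> complex \<Rightarrow> complex" where
  "partner_det A B k \<Gamma> w P z =
     (let C = cauchy_transform k \<Gamma> w (poly P) in
      det (vector [vector [poly P z, C z],
                   vector [poly A z * poly (pderiv P) z, poly A z * deriv C z - poly B z * C z]]
           :: complex ^ 2 ^ 2))"

definition electrostatic_partner ::
  "complex poly \<Rightarrow> complex poly \<Rightarrow> nat \<Rightarrow> (nat \<Rightarrow> real \<Rightarrow> complex) \<Rightarrow> (complex \<Rightarrow> complex) \<Rightarrow>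
   complex poly \<Rightarrow> complex poly" where
  "electrostatic_partner A B k \<Gamma> w P =
     (THE S. \<forall>z. z \<notin> (\<Union>j<k. arc_trace (\<Gamma> j)) \<longrightarrow> poly S z = partner_det A B k \<Gamma> w P z)"


section \<open>Discrete measures and external fields\<close>

definition dirac_sum :: "complex multiset \<Rightarrow> complex measure" where
  "dirac_sum M = measure_of UNIV (sets borel) (\<lambda>X. \<Sum>\<zeta>\<in>#M. indicator X \<zeta>)"

definition zero_counting_measure :: "complex poly \<Rightarrow> complex measure" where
  "zero_counting_measure P = dirac_sum (proots P)"

text \<open>
  A real function \<open>\<phi> = Re \<Phi>\<close> with \<open>\<Phi>\<close> multivalued may itself be multivalued, so it is represented by
  the set of pairs \<open>(U, \<phi>)\<close>, where \<open>\<phi>\<close> is a branch on the open set \<open>U\<close>. Its singularities are the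
  points near which there is no branch.
\<close>

type_synonym field = "(complex set \<times> (complex \<Rightarrow> real)) set"

definition singularities :: "field \<Rightarrow> complex set" where
  "singularities F = - (\<Union>(U, \<phi>)\<in>F. U)"

text \<open>
  \<open>D\<close> is the single-valued derivative of \<open>\<Phi>\<close>. A branch of \<open>\<phi>\<close> may be single-valued on a set on which
  \<open>\<Phi>\<close> is not, so \<open>\<Phi>\<close> is chosen locally.
\<close>

definition external_field :: "field \<Rightarrow> bool" where
  "external_field F \<longleftrightarrow> finite (singularities F) \<and>
     (\<exists>D. D holomorphic_on (- singularities F) \<and>
        (\<forall>(U, \<phi>)\<in>F. open U \<and>
           (\<forall>p\<in>U. \<exists>V \<Phi>. open V \<and> p \<in> V \<and> V \<subseteq> U \<and>
              (\<forall>z\<in>V. (\<Phi> has_field_derivative D z) (at z) \<and> \<phi> z = Re (\<Phi> z)))))"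

text \<open>\<open>\<psi> k\<close> is the branch of the external field that is used near the point \<open>\<zeta> k\<close>.\<close>

definition discrete_energy :: "nat \<Rightarrow> (nat \<Rightarrow> complex \<Rightarrow> real) \<Rightarrow> (nat \<Rightarrow> complex) \<Rightarrow> real" where
  "discrete_energy N \<psi> \<zeta> =
     (\<Sum>i<N. \<Sum>j\<in>{..<N} - {i}. ln (1 / cmod (\<zeta> i - \<zeta> j))) + 2 * (\<Sum>k<N. \<psi> k (\<zeta> k))"

text \<open>
  The gradient vanishes iff for every \<open>k\<close> the (real) derivative with respect to \<open>\<zeta> k\<close> does. Branches
  differ locally by constants, so the choice of branches does not matter.
\<close>

definition critical_measure :: "field \<Rightarrow> complex measure \<Rightarrow> bool" where
  "critical_measure F \<mu> \<longleftrightarrow>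
     (\<exists>N \<zeta>. inj_on \<zeta> {..<N} \<and> \<mu> = dirac_sum (image_mset \<zeta> (mset_set {..<N})) \<and>
        \<zeta> ` {..<N} \<inter> singularities F = {} \<and>
        (\<forall>U \<psi>. (\<forall>k<N. (U k, \<psi> k) \<in> F \<and> \<zeta> k \<in> U k) \<longrightarrow>
           (\<forall>k<N. ((\<lambda>z. discrete_energy N \<psi> (\<zeta>(k := z))) has_derivative (\<lambda>_. 0)) (at (\<zeta> k)))))"

text \<open>The field \<open>1/2 log |S / v|\<close> with \<open>v = A w\<close>, singular at the zeros of \<open>A S\<close>.\<close>

definition log_field :: "complex poly \<Rightarrow> complex poly \<Rightarrow> complex poly \<Rightarrow> field" where
  "log_field A B S =
     {(U, \<phi>). U \<inter> zeros S = {} \<and>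
        (\<exists>W. w_branch A B U W \<and> (\<forall>z\<in>U. \<phi> z = 1 / 2 * ln (cmod (poly S z / (poly A z * W z)))))}"

end

theory Submission
  imports Defs "HOL-Computational_Algebra.Fundamental_Theorem_Algebra"
begin

text \<open>
  Let \<open>C\<close> be the Cauchy transform of \<open>P w\<close>. If \<open>\<zeta>\<close> is a zero of \<open>P\<close>, say \<open>P = (z - \<zeta>) p\<close>, then
  \<open>C = m + (z - \<zeta>) c\<close>, where \<open>c\<close> is the Cauchy transform of \<open>p w\<close> and the constant \<open>m\<close> is the
  integral of \<open>p w\<close>. Inserting both factorizations in the determinant gives
  (lemma \<open>partner_det_linear_factor\<close>)

    \<open>D[P] = (z - \<zeta>)\<^sup>2 D[p] - m (A p + (z - \<zeta>) (A p' + B p))\<close>.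

  This identity has two consequences.

  First, the determinant is a polynomial off the support, by induction on the degree of \<open>P\<close>. For
  constant \<open>P\<close> the claim is that \<open>A C' - B C\<close> is a polynomial, where now \<open>C\<close> is the Cauchy transform of
  \<open>w\<close>. Integration by parts with the Pearson equation \<open>(A w)' = (A' + B) w\<close> turns its kernel into
  divided differences of \<open>A\<close> and \<open>A' + B\<close>, which are polynomials (lemma \<open>cauchy_equation\<close>). The boundary
  terms vanish, because \<open>A w\<close> has limits at the ends of the arcs, and a non-zero limit at a zero \<open>a\<close>
  of \<open>A\<close> would make \<open>w\<close> as large as \<open>1 / (z - a)\<close> and hence not integrable (lemma
  \<open>weight_limit_at_finite_end\<close>). The arcs have measure 0, so only one polynomial agrees with the
  determinant off the support, and this is the electrostatic partner \<open>S\<close>.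

  Secondly, the identity is now one between polynomials and holds on the support as well, where the
  zeros of \<open>P\<close> typically lie. It gives the value and the derivative of \<open>S\<close> at \<open>\<zeta>\<close>, and hence, if
  \<open>S\<close> and \<open>A\<close> do not vanish at \<open>\<zeta>\<close> (lemma \<open>log_derivative_at_zero\<close>),

    \<open>p \<noteq> 0\<close> and \<open>S'/S - A'/A - B/A = 2 p'/p\<close> at \<open>\<zeta>\<close>.

  The left-hand side is \<open>2 \<Phi>'\<close>, and \<open>p'/p\<close> is the sum of \<open>1 / (\<zeta> - \<zeta>')\<close> over the other zeros \<open>\<zeta>'\<close> of
  \<open>P\<close>. So the zeros of \<open>P\<close> are simple and at each of them the gradient of the discrete energy vanishes.
\<close>

section \<open>Divided differences of polynomials\<close>

text \<open>
  The coefficients in \<open>t\<close> of the divided difference \<open>(p t - p z) / (t - z)\<close> are polynomials in \<open>z\<close>,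
  so a linear functional acting in \<open>t\<close> leaves a polynomial in \<open>z\<close>. The induction changes the
  functional, because multiplication by \<open>t\<close> is absorbed into it.
\<close>

lemma functional_synthetic_div:
  fixes \<L> :: "complex poly \<Rightarrow> complex"
  assumes "\<And>p q. \<L> (p + q) = \<L> p + \<L> q" and "\<And>c p. \<L> (smult c p) = c * \<L> p"
  shows "\<exists>D. \<forall>z. poly D z = \<L> (synthetic_div p z)"
  using assms
proof (induction p arbitrary: \<L>)
  case 0
  have "\<L> 0 = 0" using 0(2)[of 0 0] by simp
  then show ?case by (intro exI[of _ 0]) simp
next
  case (pCons a p)
  have "\<L> (pCons 0 (q + r)) = \<L> (pCons 0 q) + \<L> (pCons 0 r)" for q r
    using pCons.prems(1)[of "pCons 0 q" "pCons 0 r"] by simp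
  moreover have "\<L> (pCons 0 (smult c q)) = c * \<L> (pCons 0 q)" for c q
    using pCons.prems(2)[of c "pCons 0 q"] by simp
  ultimately obtain D where D: "\<And>z. poly D z = \<L> (pCons 0 (synthetic_div p z))"
    using pCons.IH[of "\<lambda>q. \<L> (pCons 0 q)"] by auto
  have "\<L> (synthetic_div (pCons a p) z) = poly (smult (\<L> 1) p + D) z" for z
  proof -
    have "synthetic_div (pCons a p) z = smult (poly p z) 1 + pCons 0 (synthetic_div p z)" by simp
    then show ?thesis by (simp only: pCons.prems D poly_add poly_smult mult.commute)
  qed
  then show ?case by metis
qed

lemma poly_synthetic_div_same:
  fixes p :: "complex poly"
  shows "poly (synthetic_div p z) z = poly (pderiv p) z"
proof -
  have "poly (pderiv ([:-z, 1:] * q + [:c:])) z = poly q z" for q c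
    by (simp only: pderiv_mult pderiv_add) (simp add: pderiv_pCons)
  from this[of "synthetic_div p z" "poly p z"] show ?thesis
    by (simp only: synthetic_div_correct')
qed

text \<open>
  Dividing twice at the same point gives the second-order Taylor remainder of \<open>p\<close>, divided by
  \<open>(t - z)\<^sup>2\<close>; it depends polynomially on \<open>z\<close> for the same reason.
\<close>

lemma functional_synthetic_div_twice:
  fixes \<L> :: "complex poly \<Rightarrow> complex"
  assumes "\<And>p q. \<L> (p + q) = \<L> p + \<L> q" and "\<And>c p. \<L> (smult c p) = c * \<L> p"
  shows "\<exists>D. \<forall>z. poly D z = \<L> (synthetic_div (synthetic_div p z) z)"
  using assms
proof (induction p arbitrary: \<L>)
  case 0
  have "\<L> 0 = 0" using 0(2)[of 0 0] by simp
  then show ?case by (intro exI[of _ 0]) simp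
next
  case (pCons a p)
  have "\<L> (pCons 0 (q + r)) = \<L> (pCons 0 q) + \<L> (pCons 0 r)" for q r
    using pCons.prems(1)[of "pCons 0 q" "pCons 0 r"] by simp
  moreover have "\<L> (pCons 0 (smult c q)) = c * \<L> (pCons 0 q)" for c q
    using pCons.prems(2)[of c "pCons 0 q"] by simp
  ultimately obtain D where D: "\<And>z. poly D z = \<L> (pCons 0 (synthetic_div (synthetic_div p z) z))"
    using pCons.IH[of "\<lambda>q. \<L> (pCons 0 q)"] by auto
  have "\<L> (synthetic_div (synthetic_div (pCons a p) z) z) = poly (smult (\<L> 1) (pderiv p) + D) z" for z
  proof -
    have "synthetic_div (synthetic_div (pCons a p) z) z =
        smult (poly (pderiv p) z) 1 + pCons 0 (synthetic_div (synthetic_div p z) z)"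
      by (simp add: poly_synthetic_div_same)
    then show ?thesis by (simp only: pCons.prems D poly_add poly_smult mult.commute)
  qed
  then show ?case by metis
qed

lemma poly_eq_synthetic_div:
  fixes p :: "complex poly"
  shows "poly p t = poly p z + (t - z) * poly (synthetic_div p z) t"
  using arg_cong[OF synthetic_div_correct'[of z p], of "\<lambda>q. poly q t"] by (simp add: algebra_simps)

text \<open>
  This separates the kernel of \<open>A C' - B C\<close>, where \<open>C\<close> is the Cauchy transform of 1, into a
  polynomial in \<open>t\<close> and the term in parentheses, which after multiplication by \<open>w\<close> is the exact
  derivative of \<open>A w / (t - z)\<close>.
\<close>

lemma divided_difference_identity:
  fixes A B :: "complex poly"
  assumes "t \<noteq> z"
  shows "poly A z / (t - z)^2 - poly B z / (t - z) =
     poly (synthetic_div (pderiv A + B) z) t - poly (synthetic_div (synthetic_div A z) z) t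
     - (poly (pderiv A + B) t / (t - z) - poly A t / (t - z)^2)"
proof -
  define C b where "C = poly (synthetic_div (pderiv A + B) z) t"
    and "b = poly (synthetic_div (synthetic_div A z) z) t"
  have 1: "poly (pderiv A + B) t = poly (pderiv A) z + poly B z + (t - z) * C"
    unfolding C_def by (subst poly_eq_synthetic_div[of _ _ z]) simp
  have 2: "poly A t = poly A z + (t - z) * (poly (pderiv A) z + (t - z) * b)"
    unfolding b_def by (metis poly_eq_synthetic_div poly_synthetic_div_same)
  define d where "d = t - z"
  have "d \<noteq> 0" using assms by (simp add: d_def)
  then show ?thesis
    unfolding 1 2 C_def[symmetric] b_def[symmetric] d_def[symmetric] power2_eq_square
    by (simp add: field_simps)
qed

section \<open>Boundary limits on the open unit interval\<close>

text \<open>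
  The fundamental theorem of calculus when the primitive is not given at the end points: integrability
  of the derivative alone forces the limits there to exist.
\<close>

lemma has_integral_boundary_limits:
  fixes f f' :: "real \<Rightarrow> complex"
  assumes cont: "continuous_on {0<..<1} f" and "finite T"
    and deriv: "\<And>t. t \<in> {0<..<1} - T \<Longrightarrow> (f has_vector_derivative f' t) (at t)"
    and int: "f' integrable_on {0..1}"
  obtains l0 l1 where "(f \<longlongrightarrow> l0) (at_right 0)" "(f \<longlongrightarrow> l1) (at_left 1)"
    "(f' has_integral (l1 - l0)) {0..1}"
proof -
  define G where "G x = integral {0..x} f'" for x
  have G: "continuous_on {0..1} G"
    unfolding G_def by (rule indefinite_integral_continuous_1[OF int])
  \<comment> \<open>\<open>f\<close> and \<open>G\<close> differ by a constant, read off at the interior point \<open>1/2\<close>.\<close>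
  define c where "c = f (1/2) - G (1/2)"
  have step: "f t - f s = G t - G s" if "0 < s" "s \<le> t" "t < 1" for s t
  proof -
    have "(f' has_integral (f t - f s)) {s..t}"
      using that by (intro fundamental_theorem_of_calculus_interior_strong[OF \<open>finite T\<close>] deriv
          continuous_on_subset[OF cont]) auto
    moreover have "integral {0..s} f' + integral {s..t} f' = integral {0..t} f'"
      using that by (intro Henstock_Kurzweil_Integration.integral_combine
          integrable_on_subinterval[OF int]) auto
    ultimately show ?thesis unfolding G_def by (auto simp: integral_unique algebra_simps)
  qed
  have f_eq: "f t = c + G t" if "t \<in> {0<..<1}" for t
    using step[of t "1/2"] step[of "1/2" t] that unfolding c_def
    by (cases "t \<le> 1/2") (auto simp: algebra_simps)
  have "((\<lambda>t. c + G t) \<longlongrightarrow> c + G 0) (at_right 0)"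
    by (intro tendsto_intros continuous_on_Icc_at_rightD[OF G]) auto
  then have 0: "(f \<longlongrightarrow> c + G 0) (at_right 0)"
    by (rule Lim_transform_eventually)
       (use eventually_at_right_less[of 0] eventually_at_right_real[of 0 1] in
          \<open>auto elim!: eventually_mono simp: f_eq\<close>)
  have "((\<lambda>t. c + G t) \<longlongrightarrow> c + G 1) (at_left 1)"
    by (intro tendsto_intros continuous_on_Icc_at_leftD[OF G]) auto
  then have 1: "(f \<longlongrightarrow> c + G 1) (at_left 1)"
    by (rule Lim_transform_eventually)
       (use eventually_at_left_real[of 0 1] in \<open>auto elim!: eventually_mono simp: f_eq\<close>)
  have "(f' has_integral (c + G 1 - (c + G 0))) {0..1}"
    using integrable_integral[OF int] by (simp add: G_def)
  with 0 1 show ?thesis by (rule that)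
qed

text \<open>
  The two ends of an arc are named by filters, so that each boundary argument is made only once.
\<close>

definition is_end :: "real filter \<Rightarrow> bool" where
  "is_end F \<longleftrightarrow> F = at_right 0 \<or> F = at_left 1"

lemma is_end_neq_bot: "is_end F \<Longrightarrow> F \<noteq> bot"
  unfolding is_end_def by (elim disjE) simp_all

lemma eventually_end_interval:
  assumes "is_end F" "eventually P F"
  obtains c d where "0 \<le> c" "c < d" "d \<le> (1::real)" "\<And>t. t \<in> {c<..<d} \<Longrightarrow> P t"
    "eventually (\<lambda>t. t \<in> {c<..<d}) F"
  using assms unfolding is_end_def
proof (elim disjE)
  assume F: "F = at_right 0"
  then obtain b where b: "b > 0" "\<And>y. 0 < y \<Longrightarrow> y < b \<Longrightarrow> P y"
    using assms(2) by (auto simp: eventually_at_right_field)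
  have "eventually (\<lambda>t. t \<in> {0<..<min b 1}) F"
    unfolding F using b(1) by (intro eventually_at_right_real) auto
  then show ?thesis using b by (intro that[of 0 "min b 1"]) auto
next
  assume F: "F = at_left 1"
  then obtain b where b: "b < 1" "\<And>y. b < y \<Longrightarrow> y < 1 \<Longrightarrow> P y"
    using assms(2) by (auto simp: eventually_at_left_field)
  have "eventually (\<lambda>t. t \<in> {max b 0<..<1}) F"
    unfolding F using b(1) by (intro eventually_at_left_real) auto
  then show ?thesis using b by (intro that[of "max b 0" 1]) auto
qed

lemma has_derivative_ln_cmod:
  assumes "z \<noteq> 0"
  shows "((\<lambda>z. ln (cmod z)) has_derivative (\<lambda>h. Re (h / z))) (at z)"
proof -
  have "((\<lambda>z. ln (cmod z)) has_derivative (\<lambda>h. h \<bullet> sgn z / cmod z)) (at z)"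
    using assms by (auto intro!: derivative_eq_intros has_derivative_norm simp: divide_inverse mult.commute)
  moreover have "h \<bullet> sgn z / cmod z = Re (h / z)" for h
    using assms unfolding sgn_eq inner_complex_def complex_div_cnj[of h z] 
    by (simp add: cmod_power2[symmetric] Re_divide Im_divide power2_eq_square field_simps
        Re_divide_of_real Im_divide_of_real)
  ultimately show ?thesis by simp
qed
section \<open>Integration against the weight on one arc\<close>

lemma contour_integral_cong_arc:
  assumes "\<And>t. t \<in> {0<..<1} \<Longrightarrow> f (\<gamma> t) = g (\<gamma> t)"
  shows "contour_integral \<gamma> f = contour_integral \<gamma> g"
  unfolding contour_integral_integral integral_open_interval_real
  by (intro integral_cong) (simp add: assms)

text \<open>
  The properties of an arc and its weight that enter the integrals. The set \<open>T\<close> holds the break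
  points, where the arc need not be differentiable.
\<close>

locale weighted_arc =
  fixes A B :: "complex poly" and \<gamma> :: "real \<Rightarrow> complex" and w :: "complex \<Rightarrow> complex"
    and T :: "real set"
  assumes finite_T: "finite T"
    and cont_arc: "continuous_on {0<..<1} \<gamma>"
    and deriv_arc: "t \<in> {0<..<1} - T \<Longrightarrow>
          (\<gamma> has_vector_derivative vector_derivative \<gamma> (at t)) (at t)"
    and cont_deriv: "continuous_on ({0<..<1} - T) (\<lambda>t. vector_derivative \<gamma> (at t))"
    and A_nonzero: "t \<in> {0<..<1} \<Longrightarrow> poly A (\<gamma> t) \<noteq> 0"
    and cont_weight: "continuous_on {0<..<1} (\<lambda>t. w (\<gamma> t))"
    and deriv_weight: "t \<in> {0<..<1} - T \<Longrightarrow>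
          ((\<lambda>t. w (\<gamma> t)) has_vector_derivative
             w (\<gamma> t) * poly B (\<gamma> t) / poly A (\<gamma> t) * vector_derivative \<gamma> (at t)) (at t)"
    and ends: "is_end F \<Longrightarrow> ends_in \<gamma> F (zeros A)"
    and moments: "(\<lambda>t. cmod (\<gamma> t) ^ m * cmod (w (\<gamma> t)) * cmod (vector_derivative \<gamma> (at t)))
          integrable_on {0<..<1}"
begin

abbreviation D :: "real \<Rightarrow> complex" where "D t \<equiv> vector_derivative \<gamma> (at t)"

lemma polynomial_moments:
  "(\<lambda>t. cmod (poly p (\<gamma> t)) * cmod (w (\<gamma> t)) * cmod (D t)) absolutely_integrable_on {0<..<1}"
proof -
  have open_S: "open ({0<..<1} - T)" using finite_T by (intro open_Diff finite_imp_closed) auto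
  have "(\<lambda>t. \<Sum>i\<le>degree p. cmod (coeff p i) * (cmod (\<gamma> t) ^ i * cmod (w (\<gamma> t)) * cmod (D t)))
      integrable_on {0<..<1}"
    by (intro integrable_sum integrable_on_mult_right moments) auto
  then have int: "(\<lambda>t. \<Sum>i\<le>degree p. cmod (coeff p i) * (cmod (\<gamma> t) ^ i * cmod (w (\<gamma> t)) * cmod (D t)))
      integrable_on ({0<..<1} - T)"
    by (rule integrable_spike_set) (auto intro!: negligible_subset[OF negligible_finite[OF finite_T]])
  have "(\<lambda>t. cmod (poly p (\<gamma> t)) * cmod (w (\<gamma> t)) * cmod (D t))
      absolutely_integrable_on ({0<..<1} - T)"
  proof (rule measurable_bounded_by_integrable_imp_absolutely_integrable[OF _ _ int])
    show "(\<lambda>t. cmod (poly p (\<gamma> t)) * cmod (w (\<gamma> t)) * cmod (D t))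
        \<in> borel_measurable (lebesgue_on ({0<..<1} - T))"
      using open_S by (intro continuous_imp_measurable_on_sets_lebesgue continuous_intros
          continuous_on_subset[OF cont_arc] continuous_on_subset[OF cont_weight] cont_deriv) auto
    fix t
    have "cmod (poly p (\<gamma> t)) \<le> (\<Sum>i\<le>degree p. cmod (coeff p i) * cmod (\<gamma> t) ^ i)"
      unfolding poly_altdef by (rule order_trans[OF norm_sum]) (simp add: norm_mult norm_power)
    then have "cmod (poly p (\<gamma> t)) * (cmod (w (\<gamma> t)) * cmod (D t)) \<le>
        (\<Sum>i\<le>degree p. cmod (coeff p i) * cmod (\<gamma> t) ^ i) * (cmod (w (\<gamma> t)) * cmod (D t))"
      by (rule mult_right_mono) simp
    then show "norm (cmod (poly p (\<gamma> t)) * cmod (w (\<gamma> t)) * cmod (D t)) \<le>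
        (\<Sum>i\<le>degree p. cmod (coeff p i) * (cmod (\<gamma> t) ^ i * cmod (w (\<gamma> t)) * cmod (D t)))"
      by (simp add: sum_distrib_right mult.assoc)
  qed (use open_S in auto)
  then show ?thesis
    by (rule absolutely_integrable_spike_set)
       (auto intro!: negligible_subset[OF negligible_finite[OF finite_T]])
qed

text \<open>
  Off the break points the integrand is continuous, hence measurable, and a polynomial bound on \<open>f\<close>
  dominates it by the moments of the weight.
\<close>

lemma absolutely_integrable_weight:
  assumes cont: "continuous_on {0<..<1} (\<lambda>t. f (\<gamma> t))"
    and bound: "\<And>t. t \<in> {0<..<1} \<Longrightarrow> cmod (f (\<gamma> t)) \<le> M * cmod (poly p (\<gamma> t))"
  shows "(\<lambda>t. f (\<gamma> t) * w (\<gamma> t) * D t) absolutely_integrable_on {0<..<1}"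
proof -
  have open_S: "open ({0<..<1} - T)" using finite_T by (intro open_Diff finite_imp_closed) auto
  have "(\<lambda>t. M * (cmod (poly p (\<gamma> t)) * cmod (w (\<gamma> t)) * cmod (D t))) integrable_on {0<..<1}"
    by (intro integrable_on_mult_right set_lebesgue_integral_eq_integral(1) polynomial_moments)
  then have int: "(\<lambda>t. M * (cmod (poly p (\<gamma> t)) * cmod (w (\<gamma> t)) * cmod (D t))) integrable_on ({0<..<1} - T)"
    by (rule integrable_spike_set) (auto intro!: negligible_subset[OF negligible_finite[OF finite_T]])
  have "(\<lambda>t. f (\<gamma> t) * w (\<gamma> t) * D t) absolutely_integrable_on ({0<..<1} - T)"
  proof (rule measurable_bounded_by_integrable_imp_absolutely_integrable[OF _ _ int])
    show "(\<lambda>t. f (\<gamma> t) * w (\<gamma> t) * D t) \<in> borel_measurable (lebesgue_on ({0<..<1} - T))"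
      using open_S by (intro continuous_imp_measurable_on_sets_lebesgue continuous_intros
          continuous_on_subset[OF cont] continuous_on_subset[OF cont_weight] cont_deriv) auto
    fix t assume "t \<in> {0<..<1} - T"
    then have "cmod (f (\<gamma> t)) * (cmod (w (\<gamma> t)) * cmod (D t)) \<le>
        M * cmod (poly p (\<gamma> t)) * (cmod (w (\<gamma> t)) * cmod (D t))"
      by (intro mult_right_mono bound) auto
    then show "norm (f (\<gamma> t) * w (\<gamma> t) * D t) \<le>
        M * (cmod (poly p (\<gamma> t)) * cmod (w (\<gamma> t)) * cmod (D t))"
      by (simp add: norm_mult mult.assoc)
  qed (use open_S in auto)
  then show ?thesis
    by (rule absolutely_integrable_spike_set)
       (auto intro!: negligible_subset[OF negligible_finite[OF finite_T]])
qed

lemma contour_integrable_weight: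
  assumes "continuous_on {0<..<1} (\<lambda>t. f (\<gamma> t))"
    and "\<And>t. t \<in> {0<..<1} \<Longrightarrow> cmod (f (\<gamma> t)) \<le> M * cmod (poly p (\<gamma> t))"
  shows "(\<lambda>x. f x * w x) contour_integrable_on \<gamma>"
  using set_lebesgue_integral_eq_integral(1)[OF absolutely_integrable_weight[OF assms]]
  unfolding contour_integrable_on by (simp add: integrable_on_open_interval_real)

lemma contour_integrable_poly: "(\<lambda>x. poly p x * w x) contour_integrable_on \<gamma>"
  by (rule contour_integrable_weight[of _ 1 p]) (auto intro!: continuous_intros cont_arc)

lemma contour_integrable_poly_div_power:
  assumes "\<epsilon> > 0" and "\<And>t. t \<in> {0<..<1} \<Longrightarrow> \<epsilon> \<le> cmod (\<gamma> t - z)"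
  shows "(\<lambda>x. poly p x / (x - z) ^ n * w x) contour_integrable_on \<gamma>"
proof (rule contour_integrable_weight[of _ "1 / \<epsilon> ^ n" p])
  show "continuous_on {0<..<1} (\<lambda>t. poly p (\<gamma> t) / (\<gamma> t - z) ^ n)"
    using assms by (intro continuous_intros cont_arc) force
  fix t :: real assume "t \<in> {0<..<1}"
  then have "cmod (poly p (\<gamma> t)) / cmod (\<gamma> t - z) ^ n \<le> cmod (poly p (\<gamma> t)) / \<epsilon> ^ n"
    using assms by (intro divide_left_mono power_mono mult_pos_pos zero_less_power) force+
  then show "cmod (poly p (\<gamma> t) / (\<gamma> t - z) ^ n) \<le> 1 / \<epsilon> ^ n * cmod (poly p (\<gamma> t))"
    by (simp add: norm_divide norm_power)
qed

text \<open>
  Where \<open>\<bar>w\<bar>\<close> dominates \<open>1 / \<bar>x - a\<bar>\<close>, integrability of the weight bounds the variation of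
  \<open>ln \<bar>x - a\<bar>\<close> along the arc, which therefore cannot approach \<open>a\<close>.
\<close>

lemma log_variation_bound:
  assumes "0 \<le> c" "d \<le> 1" and K: "\<And>t. t \<in> {c<..<d} \<Longrightarrow> \<gamma> t \<noteq> a \<and> 1 / cmod (\<gamma> t - a) \<le> K * cmod (w (\<gamma> t))"
    and "s \<in> {c<..<d}" "t \<in> {c<..<d}"
  shows "\<bar>ln (cmod (\<gamma> t - a)) - ln (cmod (\<gamma> s - a))\<bar> \<le>
     integral {0<..<1} (\<lambda>t. \<bar>K\<bar> * (cmod (w (\<gamma> t)) * cmod (D t)))"
  using assms(4,5)
proof (induction s t rule: linorder_wlog)
  case (sym s t)
  then show ?case by (simp add: abs_minus_commute)
next
  case (le s t)
  have "((\<lambda>t. Re (D t / (\<gamma> t - a))) has_integral (ln (cmod (\<gamma> t - a)) - ln (cmod (\<gamma> s - a)))) {s..t}"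
  proof (rule fundamental_theorem_of_calculus_interior_strong[OF finite_T])
    show "continuous_on {s..t} (\<lambda>t. ln (cmod (\<gamma> t - a)))"
      using le assms K by (intro continuous_intros continuous_on_subset[OF cont_arc]) force+
    fix x assume x: "x \<in> {s<..<t} - T"
    have "((\<lambda>t. \<gamma> t - a) has_derivative (\<lambda>h. h *\<^sub>R D x)) (at x)"
      using deriv_arc[of x] x le assms by (auto simp: has_vector_derivative_def intro!: derivative_eq_intros)
    moreover have "\<gamma> x - a \<noteq> 0" using K[of x] x le by auto
    ultimately have "((\<lambda>t. ln (cmod (\<gamma> t - a))) has_derivative (\<lambda>h. Re ((h *\<^sub>R D x) / (\<gamma> x - a)))) (at x)"
      using has_derivative_compose[OF _ has_derivative_ln_cmod] by blast
    moreover have "Re ((h *\<^sub>R D x) / (\<gamma> x - a)) = h *\<^sub>R Re (D x / (\<gamma> x - a))" for h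
    proof -
      have "(h *\<^sub>R D x) / (\<gamma> x - a) = complex_of_real h * (D x / (\<gamma> x - a))"
        by (simp add: scaleR_conv_of_real)
      then show ?thesis by (simp only: times_complex.sel Re_complex_of_real Im_complex_of_real) simp
    qed
    ultimately show "((\<lambda>t. ln (cmod (\<gamma> t - a))) has_vector_derivative Re (D x / (\<gamma> x - a))) (at x)"
      by (simp add: has_vector_derivative_def)
  qed (use le in auto)
  note FTC = this
  have int: "(\<lambda>t. \<bar>K\<bar> * (cmod (w (\<gamma> t)) * cmod (D t))) absolutely_integrable_on {0<..<1}"
    using polynomial_moments[of 1] by (intro set_integrable_mult_right) simp
  have sub: "{s..t} \<subseteq> {0<..<1}" using le assms by auto
  have int': "(\<lambda>t. \<bar>K\<bar> * (cmod (w (\<gamma> t)) * cmod (D t))) integrable_on {s..t}"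
    by (rule set_lebesgue_integral_eq_integral(1), rule set_integrable_subset[OF int _ sub]) simp
  have "norm (integral {s..t} (\<lambda>t. Re (D t / (\<gamma> t - a)))) \<le>
      integral {s..t} (\<lambda>t. \<bar>K\<bar> * (cmod (w (\<gamma> t)) * cmod (D t)))"
  proof (rule Henstock_Kurzweil_Integration.integral_norm_bound_integral[OF has_integral_integrable[OF FTC] int'])
    fix x assume x: "x \<in> {s..t}"
    have "\<bar>Re (D x / (\<gamma> x - a))\<bar> \<le> 1 / cmod (\<gamma> x - a) * cmod (D x)"
      using abs_Re_le_cmod[of "D x / (\<gamma> x - a)"] by (simp add: norm_divide)
    also have "\<dots> \<le> K * cmod (w (\<gamma> x)) * cmod (D x)"
      using K[of x] x le by (intro mult_right_mono) auto
    also have "\<dots> \<le> \<bar>K\<bar> * cmod (w (\<gamma> x)) * cmod (D x)" by (intro mult_right_mono) auto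
    finally show "norm (Re (D x / (\<gamma> x - a))) \<le> \<bar>K\<bar> * (cmod (w (\<gamma> x)) * cmod (D x))"
      by (simp add: mult.assoc)
  qed
  also have "\<dots> \<le> integral {0<..<1} (\<lambda>t. \<bar>K\<bar> * (cmod (w (\<gamma> t)) * cmod (D t)))"
    by (intro integral_subset_le sub int' set_lebesgue_integral_eq_integral(1)[OF int]) auto
  finally show ?case using FTC by (simp add: integral_unique)
qed

text \<open>
  If \<open>A w\<close> had a non-zero limit at a zero \<open>a\<close> of \<open>A\<close>, then \<open>\<bar>w\<bar>\<close> would be at least a constant times
  \<open>1 / \<bar>x - a\<bar>\<close> near that end, and \<open>ln \<bar>x - a\<bar>\<close> would stay bounded while the arc tends to \<open>a\<close>.
\<close>

lemma weight_limit_at_finite_end: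
  assumes F: "is_end F" and lim: "(\<gamma> \<longlongrightarrow> a) F" and a: "poly A a = 0"
    and v: "((\<lambda>t. poly A (\<gamma> t) * w (\<gamma> t)) \<longlongrightarrow> l) F"
  shows "l = 0"
proof (rule ccontr)
  assume "l \<noteq> 0"
  have F_ne: "F \<noteq> bot" using F by (rule is_end_neq_bot)
  obtain A1 where A1: "A = [:-a, 1:] * A1" using a by (auto simp: poly_eq_0_iff_dvd elim: dvdE)
  define M where "M = cmod (poly A1 a) + 1"
  have "((\<lambda>t. cmod (poly A (\<gamma> t) * w (\<gamma> t))) \<longlongrightarrow> cmod l) F" by (intro tendsto_intros v)
  then have ev1: "eventually (\<lambda>t. cmod l / 2 < cmod (poly A (\<gamma> t) * w (\<gamma> t))) F"
    using \<open>l \<noteq> 0\<close> by (intro order_tendstoD) auto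
  have "((\<lambda>t. cmod (poly A1 (\<gamma> t))) \<longlongrightarrow> cmod (poly A1 a)) F" by (intro tendsto_intros lim)
  then have ev2: "eventually (\<lambda>t. cmod (poly A1 (\<gamma> t)) < M) F"
    by (rule order_tendstoD) (simp add: M_def)
  obtain c d where cd: "0 \<le> c" "c < d" "d \<le> (1::real)"
    and J: "\<And>t. t \<in> {c<..<d} \<Longrightarrow> cmod l / 2 < cmod (poly A (\<gamma> t) * w (\<gamma> t)) \<and> cmod (poly A1 (\<gamma> t)) < M"
    and evJ: "eventually (\<lambda>t. t \<in> {c<..<d}) F"
    using eventually_end_interval[OF F eventually_conj[OF ev1 ev2]] by metis
  have K: "\<gamma> t \<noteq> a \<and> 1 / cmod (\<gamma> t - a) \<le> 2 * M / cmod l * cmod (w (\<gamma> t))" if t: "t \<in> {c<..<d}" for t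
  proof
    show "\<gamma> t \<noteq> a" using A_nonzero[of t] a t cd by auto
    then have pos: "cmod (\<gamma> t - a) > 0" by simp
    have "poly A (\<gamma> t) = (\<gamma> t - a) * poly A1 (\<gamma> t)" by (simp add: A1 algebra_simps)
    then have "cmod l / 2 < cmod (\<gamma> t - a) * (cmod (poly A1 (\<gamma> t)) * cmod (w (\<gamma> t)))"
      using J[OF t] by (simp add: norm_mult mult.assoc)
    also have "\<dots> \<le> cmod (\<gamma> t - a) * (M * cmod (w (\<gamma> t)))"
      using J[OF t] by (intro mult_left_mono mult_right_mono) auto
    finally show "1 / cmod (\<gamma> t - a) \<le> 2 * M / cmod l * cmod (w (\<gamma> t))"
      using pos \<open>l \<noteq> 0\<close> by (simp add: field_simps)
  qed
  define I where "I = integral {0<..<1} (\<lambda>t. \<bar>2 * M / cmod l\<bar> * (cmod (w (\<gamma> t)) * cmod (D t)))"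
  obtain t0 where t0: "t0 \<in> {c<..<d}" using cd dense by auto
  \<comment> \<open>By the variation bound, \<open>ln \<bar>\<gamma> s - a\<bar>\<close> cannot fall below \<open>b\<close>.\<close>
  define b where "b = ln (cmod (\<gamma> t0 - a)) - I"
  have "((\<lambda>t. cmod (\<gamma> t - a)) \<longlongrightarrow> 0) F" using tendsto_norm[OF tendsto_diff[OF lim tendsto_const[of a]]] by simp
  then have "eventually (\<lambda>t. cmod (\<gamma> t - a) < exp b) F" by (rule order_tendstoD) simp
  with evJ have "eventually (\<lambda>t. t \<in> {c<..<d} \<and> cmod (\<gamma> t - a) < exp b) F" by (rule eventually_conj)
  then obtain s where s: "s \<in> {c<..<d}" "cmod (\<gamma> s - a) < exp b"
    using eventually_happens'[OF F_ne] by blast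
  have "ln (cmod (\<gamma> s - a)) < b"
    using s K[OF s(1)] by (subst ln_less_cancel_iff[of _ "exp b", simplified]) auto
  moreover have "\<bar>ln (cmod (\<gamma> t0 - a)) - ln (cmod (\<gamma> s - a))\<bar> \<le> I"
    unfolding I_def using cd K s(1) t0 by (intro log_variation_bound) auto
  ultimately show False by (simp add: b_def)
qed

text \<open>
  The Pearson equation \<open>(A w)' = (A' + B) w\<close>.
\<close>

lemma derivative_A_weight:
  assumes "t \<in> {0<..<1} - T"
  shows "((\<lambda>t. poly A (\<gamma> t) * w (\<gamma> t)) has_vector_derivative
            poly (pderiv A + B) (\<gamma> t) * w (\<gamma> t) * D t) (at t)"
proof -
  have A: "((\<lambda>t. poly A (\<gamma> t)) has_vector_derivative (D t * poly (pderiv A) (\<gamma> t))) (at t)"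
    using field_vector_diff_chain_at[OF deriv_arc[OF assms] poly_DERIV[of A "\<gamma> t"]] by (simp add: o_def)
  show ?thesis
    using has_vector_derivative_mult[OF A deriv_weight[OF assms]] A_nonzero[of t] assms
    by (simp add: algebra_simps)
qed

text \<open>
  The integrand is the derivative of \<open>A w / (x - z)\<close>, so the integral is the difference of its
  boundary limits. Both vanish: at a finite end because \<open>A w\<close> tends to 0 there, at an infinite end
  because \<open>A w\<close> has a finite limit and \<open>1 / (x - z)\<close> tends to 0.
\<close>

lemma pearson_cauchy_kernel:
  assumes "\<epsilon> > 0" and far: "\<And>t. t \<in> {0<..<1} \<Longrightarrow> \<epsilon> \<le> cmod (\<gamma> t - z)"
  shows "((\<lambda>x. (poly (pderiv A + B) x / (x - z) - poly A x / (x - z)^2) * w x)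
           has_contour_integral 0) \<gamma>"
proof -
  have v_cont: "continuous_on {0<..<1} (\<lambda>t. poly A (\<gamma> t) * w (\<gamma> t))"
    by (intro continuous_intros cont_arc cont_weight)
  have ne: "\<gamma> t - z \<noteq> 0" if "t \<in> {0<..<1}" for t using far[OF that] \<open>\<epsilon> > 0\<close> by auto
  have "(\<lambda>x. poly (pderiv A + B) x * w x) contour_integrable_on \<gamma>" by (rule contour_integrable_poly)
  then obtain m0 m1 where v: "((\<lambda>t. poly A (\<gamma> t) * w (\<gamma> t)) \<longlongrightarrow> m0) (at_right 0)"
      "((\<lambda>t. poly A (\<gamma> t) * w (\<gamma> t)) \<longlongrightarrow> m1) (at_left 1)"
    using has_integral_boundary_limits[OF v_cont finite_T derivative_A_weight]
    unfolding contour_integrable_on by blast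
  have lim0: "((\<lambda>t. poly A (\<gamma> t) * w (\<gamma> t) / (\<gamma> t - z)) \<longlongrightarrow> 0) F" if F: "is_end F" for F
  proof -
    obtain m where m: "((\<lambda>t. poly A (\<gamma> t) * w (\<gamma> t)) \<longlongrightarrow> m) F"
      using v F by (auto simp: is_end_def)
    from ends[OF F] show ?thesis unfolding ends_in_def
    proof (elim disjE bexE)
      fix a assume a: "a \<in> zeros A" "(\<gamma> \<longlongrightarrow> a) F"
      with m F have "m = 0" using weight_limit_at_finite_end[of F a m] by auto
      have "eventually (\<lambda>t. \<epsilon> \<le> cmod (\<gamma> t - z)) F"
        using F eventually_at_right_real[of 0 1] eventually_at_left_real[of 0 1] far
        by (auto simp: is_end_def elim!: eventually_mono)
      moreover have "((\<lambda>t. cmod (\<gamma> t - z)) \<longlongrightarrow> cmod (a - z)) F" by (intro tendsto_intros a)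
      moreover have "F \<noteq> bot" using F by (rule is_end_neq_bot)
      ultimately have "\<epsilon> \<le> cmod (a - z)" by (intro tendsto_lowerbound)
      then have "a - z \<noteq> 0" using \<open>\<epsilon> > 0\<close> by auto
      then have "((\<lambda>t. poly A (\<gamma> t) * w (\<gamma> t) / (\<gamma> t - z)) \<longlongrightarrow> m / (a - z)) F"
        by (intro tendsto_intros m a)
      then show ?thesis by (simp add: \<open>m = 0\<close>)
    next
      assume "filterlim \<gamma> at_infinity F"
      then have "filterlim (\<lambda>t. \<gamma> t - z) at_infinity F"
        using tendsto_add_filterlim_at_infinity'[of \<gamma> F "\<lambda>_. -z" "-z"] by simp
      then show ?thesis by (rule tendsto_divide_0[OF m])
    qed
  qed
  have "(\<lambda>x. poly (pderiv A + B) x / (x - z) ^ 1 * w x - poly A x / (x - z) ^ 2 * w x) contour_integrable_on \<gamma>"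
    by (intro contour_integrable_diff contour_integrable_poly_div_power[OF assms])
  then have int: "(\<lambda>t. (poly (pderiv A + B) (\<gamma> t) / (\<gamma> t - z) - poly A (\<gamma> t) / (\<gamma> t - z)^2) * w (\<gamma> t) * D t)
      integrable_on {0..1}"
    unfolding contour_integrable_on by (simp add: algebra_simps)
  have cont: "continuous_on {0<..<1} (\<lambda>t. poly A (\<gamma> t) * w (\<gamma> t) / (\<gamma> t - z))"
    using ne by (intro continuous_intros cont_arc cont_weight) auto
  have deriv: "((\<lambda>t. poly A (\<gamma> t) * w (\<gamma> t) / (\<gamma> t - z)) has_vector_derivative
      (poly (pderiv A + B) (\<gamma> t) / (\<gamma> t - z) - poly A (\<gamma> t) / (\<gamma> t - z)^2) * w (\<gamma> t) * D t) (at t)"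
    if t: "t \<in> {0<..<1} - T" for t
  proof -
    have ne': "\<gamma> t - z \<noteq> 0" using t ne by auto
    have "((\<lambda>x. inverse (x - z)) has_field_derivative - inverse ((\<gamma> t - z)^2)) (at (\<gamma> t))"
      using ne' by (auto intro!: derivative_eq_intros simp: power2_eq_square field_simps)
    from field_vector_diff_chain_at[OF deriv_arc[OF t] this]
    have "((\<lambda>t. inverse (\<gamma> t - z)) has_vector_derivative (D t * - inverse ((\<gamma> t - z)^2))) (at t)"
      by (simp add: o_def)
    from has_vector_derivative_mult[OF derivative_A_weight[OF t] this]
    show ?thesis by (simp add: divide_inverse algebra_simps)
  qed
  obtain l0 l1 where l: "((\<lambda>t. poly A (\<gamma> t) * w (\<gamma> t) / (\<gamma> t - z)) \<longlongrightarrow> l0) (at_right 0)"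
      "((\<lambda>t. poly A (\<gamma> t) * w (\<gamma> t) / (\<gamma> t - z)) \<longlongrightarrow> l1) (at_left 1)"
      "((\<lambda>t. (poly (pderiv A + B) (\<gamma> t) / (\<gamma> t - z) - poly A (\<gamma> t) / (\<gamma> t - z)^2) * w (\<gamma> t) * D t)
         has_integral (l1 - l0)) {0..1}"
    using has_integral_boundary_limits[OF cont finite_T deriv int] by blast
  have "l0 = 0" using tendsto_unique[OF _ l(1) lim0[of "at_right 0"]] by (auto simp: is_end_def)
  moreover have "l1 = 0" using tendsto_unique[OF _ l(2) lim0[of "at_left 1"]]
    by (auto simp: is_end_def trivial_limit_at_left_real)
  ultimately show ?thesis using l(3) by (simp add: has_contour_integral)
qed

text \<open>
  Differentiation under the integral sign, done by hand because the arc may be unbounded and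
  of infinite length: the second-order remainder of the kernel is at most \<open>2 \<bar>h\<bar>\<^sup>2 / \<epsilon>\<^sup>3\<close> as long as
  \<open>\<bar>h\<bar> < \<epsilon> / 2\<close>.
\<close>

lemma cauchy_kernel_derivative:
  assumes "\<epsilon> > 0" and far: "\<And>t. t \<in> {0<..<1} \<Longrightarrow> \<epsilon> \<le> cmod (\<gamma> t - z)"
  shows "((\<lambda>z. contour_integral \<gamma> (\<lambda>x. poly p x * w x / (x - z))) has_field_derivative
            contour_integral \<gamma> (\<lambda>x. poly p x / (x - z)^2 * w x)) (at z)"
proof -
  define C where "C z = contour_integral \<gamma> (\<lambda>x. poly p x * w x / (x - z))" for z
  define C' where "C' = contour_integral \<gamma> (\<lambda>x. poly p x / (x - z)^2 * w x)"
  have C_alt: "C y = contour_integral \<gamma> (\<lambda>x. poly p x / (x - y)^1 * w x)" for y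
    unfolding C_def by (simp add: mult.commute)
  define I where "I = integral {0<..<1} (\<lambda>t. cmod (poly p (\<gamma> t)) * cmod (w (\<gamma> t)) * cmod (D t))"
  have est: "cmod ((C (z + h) - C z) / h - C') \<le> cmod h * (2 / \<epsilon>^3 * I)" if h: "h \<noteq> 0" "cmod h < \<epsilon> / 2" for h
  proof -
    have far_h: "\<epsilon> / 2 \<le> cmod (\<gamma> t - (z + h))" if "t \<in> {0<..<1}" for t
      using far[OF that] h(2) norm_triangle_ineq2[of "\<gamma> t - z" h] by (simp add: algebra_simps)
    define R where "R x = poly p x / (x - (z + h))^1 * w x - poly p x / (x - z)^1 * w x
        - h * (poly p x / (x - z)^2 * w x)" for x
    have int1: "(\<lambda>x. poly p x / (x - (z + h))^1 * w x) contour_integrable_on \<gamma>"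
      using \<open>\<epsilon> > 0\<close> by (intro contour_integrable_poly_div_power[of "\<epsilon> / 2"] far_h) auto
    note int2 = contour_integrable_poly_div_power[OF assms, of p]
    have "C (z + h) - C z - h * C' = contour_integral \<gamma> R"
      unfolding R_def C_alt C'_def using int1 int2[of 1] int2[of 2]
      by (simp only: contour_integral_diff contour_integral_lmul contour_integrable_diff contour_integrable_lmul)
    have "R contour_integrable_on \<gamma>"
      unfolding R_def by (intro contour_integrable_diff contour_integrable_lmul int1 int2)
    then have intR: "(\<lambda>t. R (\<gamma> t) * D t) integrable_on {0<..<1}"
      unfolding contour_integrable_on by (simp add: integrable_on_open_interval_real)
    have intp: "(\<lambda>t. cmod (poly p (\<gamma> t)) * cmod (w (\<gamma> t)) * cmod (D t)) integrable_on {0<..<1}"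
      by (rule set_lebesgue_integral_eq_integral(1)[OF polynomial_moments])
    have "cmod (contour_integral \<gamma> R) = cmod (integral {0<..<1} (\<lambda>t. R (\<gamma> t) * D t))"
      by (simp add: contour_integral_integral integral_open_interval_real)
    also have "\<dots> \<le> integral {0<..<1} (\<lambda>t. cmod h ^ 2 * (2 / \<epsilon>^3) *
        (cmod (poly p (\<gamma> t)) * cmod (w (\<gamma> t)) * cmod (D t)))"
    proof (rule Henstock_Kurzweil_Integration.integral_norm_bound_integral[OF intR])
      show "(\<lambda>t. cmod h ^ 2 * (2 / \<epsilon>^3) * (cmod (poly p (\<gamma> t)) * cmod (w (\<gamma> t)) * cmod (D t)))
          integrable_on {0<..<1}"
        by (intro integrable_on_mult_right intp)
      fix t :: real assume t: "t \<in> {0<..<1}"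
      define u where "u = \<gamma> t - z"
      have u: "\<epsilon> \<le> cmod u" "\<epsilon> / 2 \<le> cmod (u - h)"
        using far[OF t] far_h[OF t] by (simp_all add: u_def algebra_simps)
      then have "u \<noteq> 0" "u - h \<noteq> 0" using \<open>\<epsilon> > 0\<close> by auto
      then have eq: "1 / (u - h) - 1 / u - h / u^2 = h^2 / (u^2 * (u - h))"
        by (simp add: divide_simps power2_eq_square) (simp add: algebra_simps)
      have "R (\<gamma> t) = poly p (\<gamma> t) * w (\<gamma> t) * (1 / (u - h) - 1 / u - h / u^2)"
        unfolding R_def u_def by (simp add: algebra_simps)
      then have "norm (R (\<gamma> t) * D t) =
          cmod h ^ 2 * (1 / (cmod u ^ 2 * cmod (u - h))) * (cmod (poly p (\<gamma> t)) * cmod (w (\<gamma> t)) * cmod (D t))"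
        unfolding eq by (simp add: norm_mult norm_divide norm_power)
      also have "\<dots> \<le> cmod h ^ 2 * (1 / (\<epsilon>^2 * (\<epsilon> / 2))) * (cmod (poly p (\<gamma> t)) * cmod (w (\<gamma> t)) * cmod (D t))"
        using u \<open>\<epsilon> > 0\<close>
        by (intro mult_right_mono mult_left_mono divide_left_mono mult_mono power_mono mult_pos_pos) (auto intro: order_less_le_trans)
      also have "1 / (\<epsilon>^2 * (\<epsilon> / 2)) = 2 / \<epsilon>^3" by (simp add: power2_eq_square power3_eq_cube)
      finally show "norm (R (\<gamma> t) * D t) \<le> cmod h ^ 2 * (2 / \<epsilon>^3) *
          (cmod (poly p (\<gamma> t)) * cmod (w (\<gamma> t)) * cmod (D t))" .
    qed
    also have "\<dots> = cmod h ^ 2 * (2 / \<epsilon>^3) * I" unfolding I_def by simp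
    finally have "cmod (C (z + h) - C z - h * C') \<le> cmod h ^ 2 * (2 / \<epsilon>^3) * I"
      using \<open>C (z + h) - C z - h * C' = contour_integral \<gamma> R\<close> by simp
    moreover have "(C (z + h) - C z) / h - C' = (C (z + h) - C z - h * C') / h"
      using h by (simp add: field_simps)
    ultimately show ?thesis
      using h by (simp add: norm_divide field_simps power2_eq_square)
  qed
  have "((\<lambda>h. (C (z + h) - C z) / h - C') \<longlongrightarrow> 0) (at 0)"
  proof (rule Lim_null_comparison)
    show "eventually (\<lambda>h. norm ((C (z + h) - C z) / h - C') \<le> cmod h * (2 / \<epsilon>^3 * I)) (at 0)"
      unfolding eventually_at using \<open>\<epsilon> > 0\<close> est by (intro exI[of _ "\<epsilon> / 2"]) (auto simp: dist_norm)
    show "((\<lambda>h. cmod h * (2 / \<epsilon>^3 * I)) \<longlongrightarrow> 0) (at 0)"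
      by (rule tendsto_eq_intros refl)+ simp
  qed
  then have "(C has_field_derivative C') (at z)"
    unfolding DERIV_def by (rule LIM_zero_cancel)
  then show ?thesis by (simp add: C_def[abs_def] C'_def)
qed

end

section \<open>Arcs and their traces\<close>

lemma arc_locally_analytic:
  assumes "finite T"
    and pieces: "\<forall>a b. 0 < a \<and> a < b \<and> b < 1 \<and> T \<inter> {a<..<b} = {} \<longrightarrow>
        (\<exists>g. g analytic_on (complex_of_real ` {a..b}) \<and>
             (\<forall>t\<in>{a..b}. \<gamma> t = g (complex_of_real t) \<and> deriv g (complex_of_real t) \<noteq> 0))"
    and t: "t \<in> {0<..<1} - T"
  shows "(\<gamma> has_vector_derivative vector_derivative \<gamma> (at t)) (at t)"
    and "isCont (\<lambda>t. vector_derivative \<gamma> (at t)) t"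
proof -
  have "open ({0<..<1} - T)" using \<open>finite T\<close> by (intro open_Diff finite_imp_closed) auto
  then obtain e where e: "e > 0" "cball t e \<subseteq> {0<..<1} - T" using t open_contains_cball by blast
  define a b where "a = t - e" and "b = t + e"
  have sub: "{a..b} \<subseteq> {0<..<1} - T" using e by (simp add: a_def b_def cball_eq_atLeastAtMost)
  have "a \<in> {a..b}" "b \<in> {a..b}" using e(1) by (simp_all add: a_def b_def)
  then have "a \<in> {0<..<1}" "b \<in> {0<..<1}" using sub by blast+
  then have ab: "a < t" "t < b" "0 < a" "a < b" "b < 1" using e(1) by (auto simp: a_def b_def)
  have "T \<inter> {a<..<b} = {}"
    using sub greaterThanLessThan_subseteq_atLeastAtMost_iff[of a b a b] by blast
  with pieces ab(3-5) obtain g where g: "g analytic_on (complex_of_real ` {a..b})"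
    "\<And>s. s \<in> {a..b} \<Longrightarrow> \<gamma> s = g (complex_of_real s)" by blast
  have an: "g analytic_on {complex_of_real s}" if "s \<in> {a..b}" for s
    using that by (intro analytic_on_subset[OF g(1)]) auto
  have der: "(\<gamma> has_vector_derivative deriv g (complex_of_real s)) (at s)" if s: "s \<in> {a<..<b}" for s
  proof -
    have "g field_differentiable at (complex_of_real s)"
      using an[of s] s by (intro analytic_on_imp_differentiable_at) auto
    then have "(g has_field_derivative deriv g (complex_of_real s)) (at (complex_of_real s))"
      by (simp add: DERIV_deriv_iff_field_differentiable)
    then have "((\<lambda>x. g (complex_of_real x)) has_vector_derivative deriv g (complex_of_real s)) (at s)"
      by (rule has_vector_derivative_real_field)
    then show ?thesis
      using s g(2) by (elim has_vector_derivative_transform_within_open[of _ _ _ "{a<..<b}"]) auto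
  qed
  show "(\<gamma> has_vector_derivative vector_derivative \<gamma> (at t)) (at t)"
    using der[of t] ab by (auto simp: vector_derivative_at)
  have "(deriv g) analytic_on {complex_of_real t}"
    using an[of t] ab by (intro analytic_deriv) auto
  then have "isCont (deriv g) (complex_of_real t)"
    by (simp add: analytic_at_imp_isCont)
  then have "isCont (\<lambda>s. deriv g (complex_of_real s)) t"
    using isCont_o2[of t complex_of_real "deriv g"] by simp
  moreover have "eventually (\<lambda>s. s \<in> {a<..<b}) (nhds t)"
    using ab by (intro eventually_nhds_in_open) auto
  then have "eventually (\<lambda>s. vector_derivative \<gamma> (at s) = deriv g (complex_of_real s)) (nhds t)"
    by (rule eventually_mono) (use der vector_derivative_at in blast)
  ultimately show "isCont (\<lambda>t. vector_derivative \<gamma> (at t)) t"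
    using isCont_cong by fast
qed

text \<open>
  A differentiable image of a real interval has planar measure 0, and break points and end points
  are finite in number.
\<close>

lemma negligible_arc_trace:
  assumes "jordan_piecewise_analytic_arc \<gamma>"
  shows "negligible (arc_trace \<gamma>)"
proof -
  obtain T where T: "finite T" and pieces: "\<forall>a b. 0 < a \<and> a < b \<and> b < 1 \<and> T \<inter> {a<..<b} = {} \<longrightarrow>
        (\<exists>g. g analytic_on (complex_of_real ` {a..b}) \<and>
             (\<forall>t\<in>{a..b}. \<gamma> t = g (complex_of_real t) \<and> deriv g (complex_of_real t) \<noteq> 0))"
    using assms unfolding jordan_piecewise_analytic_arc_def by blast
  have "\<gamma> differentiable_on ({0<..<1} - T)"
    unfolding differentiable_on_def
  proof
    fix t assume "t \<in> {0<..<1} - T"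
    from arc_locally_analytic(1)[OF T pieces this] have "\<gamma> differentiable (at t)"
      by (rule differentiableI_vector)
    then show "\<gamma> differentiable (at t within {0<..<1} - T)" by (rule differentiable_at_withinI)
  qed
  then have "negligible (\<gamma> ` ({0<..<1} - T))"
    by (intro negligible_differentiable_image_lowdim) auto
  moreover have "negligible (\<gamma> ` T)" using T by (intro negligible_finite) auto
  ultimately have "negligible (arc_interior \<gamma>)"
    unfolding arc_interior_def by (rule negligible_subset[OF negligible_Un]) auto
  moreover have "finite {a. (\<gamma> \<longlongrightarrow> a) F}" if "F \<noteq> bot" for F :: "real filter"
  proof (cases "\<exists>a. (\<gamma> \<longlongrightarrow> a) F")
    case True
    then obtain a where "(\<gamma> \<longlongrightarrow> a) F" by blast
    then have "{a. (\<gamma> \<longlongrightarrow> a) F} \<subseteq> {a}" using tendsto_unique[OF that] by blast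
    then show ?thesis by (rule finite_subset) auto
  qed auto
  then have "negligible ({a. (\<gamma> \<longlongrightarrow> a) (at_right 0)} \<union> {a. (\<gamma> \<longlongrightarrow> a) (at_left 1)})"
    by (intro negligible_finite) auto
  ultimately have "negligible (arc_interior \<gamma> \<union> ({a. (\<gamma> \<longlongrightarrow> a) (at_right 0)} \<union> {a. (\<gamma> \<longlongrightarrow> a) (at_left 1)}))"
    by (rule negligible_Un)
  moreover have "arc_trace \<gamma> = arc_interior \<gamma> \<union> ({a. (\<gamma> \<longlongrightarrow> a) (at_right 0)} \<union> {a. (\<gamma> \<longlongrightarrow> a) (at_left 1)})"
    unfolding arc_trace_def by auto
  ultimately show ?thesis by simp
qed

text \<open>
  The middle part of the arc is compact, and near each end the arc is close to a point other than \<open>z\<close>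
  or to infinity.
\<close>

lemma positive_distance_to_arc:
  assumes cont: "continuous_on {0<..<1} \<gamma>"
    and ends: "\<And>F. is_end F \<Longrightarrow> ends_in \<gamma> F Z" and z: "z \<notin> arc_trace \<gamma>"
  obtains \<epsilon> where "\<epsilon> > 0" "\<And>t. t \<in> {0<..<1} \<Longrightarrow> \<epsilon> \<le> cmod (\<gamma> t - z)"
proof -
  have near_end: "\<exists>e>0. eventually (\<lambda>t. e \<le> cmod (\<gamma> t - z)) F" if F: "is_end F" for F
    using ends[OF F] unfolding ends_in_def
  proof (elim disjE bexE)
    fix a assume a: "(\<gamma> \<longlongrightarrow> a) F"
    then have "a \<noteq> z" using z F unfolding arc_trace_def is_end_def by auto
    moreover have "((\<lambda>t. cmod (\<gamma> t - z)) \<longlongrightarrow> cmod (a - z)) F" by (intro tendsto_intros a)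
    ultimately have "eventually (\<lambda>t. cmod (a - z) / 2 < cmod (\<gamma> t - z)) F"
      by (intro order_tendstoD) auto
    then show ?thesis using \<open>a \<noteq> z\<close>
      by (intro exI[of _ "cmod (a - z) / 2"]) (auto elim: eventually_mono)
  next
    assume "filterlim \<gamma> at_infinity F"
    then have "eventually (\<lambda>t. cmod z + 1 \<le> cmod (\<gamma> t)) F"
      using add_nonneg_pos[OF norm_ge_zero zero_less_one, of z]
      by (simp add: filterlim_at_infinity[of 0])
    then have "eventually (\<lambda>t. 1 \<le> cmod (\<gamma> t - z)) F"
      by (rule eventually_mono) (smt (verit) norm_triangle_ineq2)
    then show ?thesis by (intro exI[of _ 1]) auto
  qed
  obtain e0 where e0: "e0 > 0" "eventually (\<lambda>t. e0 \<le> cmod (\<gamma> t - z)) (at_right 0)"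
    using near_end[of "at_right 0"] by (auto simp: is_end_def)
  obtain e1 where e1: "e1 > 0" "eventually (\<lambda>t. e1 \<le> cmod (\<gamma> t - z)) (at_left 1)"
    using near_end[of "at_left 1"] by (auto simp: is_end_def)
  obtain b0 where b0: "b0 > 0" "\<And>t. 0 < t \<Longrightarrow> t < b0 \<Longrightarrow> e0 \<le> cmod (\<gamma> t - z)"
    using e0(2) by (auto simp: eventually_at_right_field)
  obtain b1 where b1: "b1 < 1" "\<And>t. b1 < t \<Longrightarrow> t < 1 \<Longrightarrow> e1 \<le> cmod (\<gamma> t - z)"
    using e1(2) by (auto simp: eventually_at_left_field)
  define I where "I = {min b0 (1/2)..max b1 (1/2)}"
  have "1/2 \<in> I" and "compact I" by (simp_all add: I_def)
  have "I \<subseteq> {0<..<1}" unfolding I_def using b0 b1 by auto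
  then have "continuous_on I (\<lambda>t. cmod (\<gamma> t - z))"
    by (intro continuous_intros continuous_on_subset[OF cont])
  then obtain s where s: "s \<in> I" "\<And>t. t \<in> I \<Longrightarrow> cmod (\<gamma> s - z) \<le> cmod (\<gamma> t - z)"
    using continuous_attains_inf[of I "\<lambda>t. cmod (\<gamma> t - z)"] \<open>1/2 \<in> I\<close> \<open>compact I\<close> by blast
  have "\<gamma> s \<noteq> z" using z s(1) \<open>I \<subseteq> {0<..<1}\<close> unfolding arc_trace_def arc_interior_def by auto
  show ?thesis
  proof (rule that[of "min (cmod (\<gamma> s - z)) (min e0 e1)"])
    show "min (cmod (\<gamma> s - z)) (min e0 e1) > 0" using \<open>\<gamma> s \<noteq> z\<close> e0 e1 by auto
    fix t :: real assume t: "t \<in> {0<..<1}"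
    show "min (cmod (\<gamma> s - z)) (min e0 e1) \<le> cmod (\<gamma> t - z)"
    proof (cases "t \<in> I")
      case True
      then show ?thesis using s(2)[OF True] by (simp add: min_le_iff_disj)
    next
      case False
      then have "t < b0 \<or> b1 < t" unfolding I_def by auto
      then show ?thesis using b0(2)[of t] b1(2)[of t] t by (auto simp: min_le_iff_disj)
    qed
  qed
qed

lemma not_in_arc_trace_of_distance:
  assumes "\<epsilon> > 0" and far: "\<And>t. t \<in> {0<..<1} \<Longrightarrow> \<epsilon> \<le> cmod (\<gamma> t - z)"
  shows "z \<notin> arc_trace \<gamma>"
proof
  assume "z \<in> arc_trace \<gamma>"
  then consider "z \<in> arc_interior \<gamma>" | F where "is_end F" "(\<gamma> \<longlongrightarrow> z) F"
    unfolding arc_trace_def is_end_def by auto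
  then show False
  proof cases
    case 1
    then show ?thesis using assms unfolding arc_interior_def by force
  next
    case 2
    have "eventually (\<lambda>t. \<epsilon> \<le> cmod (\<gamma> t - z)) F"
      using 2(1) eventually_at_right_real[of 0 1] eventually_at_left_real[of 0 1] far
      by (auto simp: is_end_def elim!: eventually_mono)
    moreover have "((\<lambda>t. cmod (\<gamma> t - z)) \<longlongrightarrow> cmod (z - z)) F" by (intro tendsto_intros 2)
    ultimately have "\<epsilon> \<le> cmod (z - z)" using is_end_neq_bot[OF 2(1)] by (intro tendsto_lowerbound)
    then show False using \<open>\<epsilon> > 0\<close> by simp
  qed
qed

lemma closed_arc_trace:
  assumes "continuous_on {0<..<1} \<gamma>" and "\<And>F. is_end F \<Longrightarrow> ends_in \<gamma> F Z"
  shows "closed (arc_trace \<gamma>)"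
  unfolding closed_def open_dist
proof
  fix z assume "z \<in> - arc_trace \<gamma>"
  then obtain \<epsilon> where \<epsilon>: "\<epsilon> > 0" "\<And>t. t \<in> {0<..<1} \<Longrightarrow> \<epsilon> \<le> cmod (\<gamma> t - z)"
    using positive_distance_to_arc[OF assms] by auto
  have "y \<in> - arc_trace \<gamma>" if y: "dist y z < \<epsilon>" for y
  proof -
    have "\<epsilon> - dist y z \<le> cmod (\<gamma> t - y)" if "t \<in> {0<..<1}" for t
      using \<epsilon>(2)[OF that] norm_triangle_ineq[of "\<gamma> t - y" "y - z"] by (simp add: dist_norm)
    then show ?thesis using not_in_arc_trace_of_distance[of "\<epsilon> - dist y z" \<gamma> y] y by auto
  qed
  then show "\<exists>e>0. \<forall>y. dist y z < e \<longrightarrow> y \<in> - arc_trace \<gamma>" using \<epsilon>(1) by blast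
qed

section \<open>The electrostatic partner\<close>

locale semiclassical =
  fixes A B :: "complex poly" and k :: nat and \<Gamma> :: "nat \<Rightarrow> real \<Rightarrow> complex"
    and w :: "complex \<Rightarrow> complex"
  assumes semiclassical: "semiclassical_weight A B k \<Gamma> w"
begin

lemma exists_weighted_arc:
  assumes "j < k"
  obtains T where "weighted_arc A B (\<Gamma> j) w T"
proof -
  have jordan: "jordan_piecewise_analytic_arc (\<Gamma> j)"
    and ends: "ends_in (\<Gamma> j) (at_right 0) (zeros A)" "ends_in (\<Gamma> j) (at_left 1) (zeros A)"
    and disj: "arc_interior (\<Gamma> j) \<inter> zeros A = {}"
    and moments: "\<And>m. (\<lambda>t. cmod (\<Gamma> j t) ^ m * cmod (w (\<Gamma> j t)) * cmod (vector_derivative (\<Gamma> j) (at t)))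
                  integrable_on {0<..<1}"
    using semiclassical assms unfolding semiclassical_weight_def by auto
  have "\<exists>U W c. w_branch A B U W \<and> arc_interior (\<Gamma> j) \<subseteq> U \<and> c \<noteq> 0 \<and>
                    (\<forall>z\<in>arc_interior (\<Gamma> j). w z = c * W z)"
    using semiclassical assms unfolding semiclassical_weight_def by blast
  then obtain U W c where branch: "w_branch A B U W" "arc_interior (\<Gamma> j) \<subseteq> U"
      "\<And>z. z \<in> arc_interior (\<Gamma> j) \<Longrightarrow> w z = c * W z" by blast
  obtain L where L: "\<And>z. z \<in> U \<Longrightarrow> (L has_field_derivative poly B z / poly A z) (at z)"
      "\<And>z. z \<in> U \<Longrightarrow> W z = exp (L z)"
    using branch(1) unfolding w_branch_def by blast
  obtain T where T: "finite T" and pieces: "\<forall>a b. 0 < a \<and> a < b \<and> b < 1 \<and> T \<inter> {a<..<b} = {} \<longrightarrow>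
        (\<exists>g. g analytic_on (complex_of_real ` {a..b}) \<and>
             (\<forall>t\<in>{a..b}. \<Gamma> j t = g (complex_of_real t) \<and> deriv g (complex_of_real t) \<noteq> 0))"
    using jordan unfolding jordan_piecewise_analytic_arc_def by blast
  have cont: "continuous_on {0<..<1} (\<Gamma> j)" using jordan unfolding jordan_piecewise_analytic_arc_def by blast
  have inU: "\<Gamma> j t \<in> U" if "t \<in> {0<..<1}" for t using branch(2) that unfolding arc_interior_def by auto
  have w_eq: "w (\<Gamma> j t) = c * exp (L (\<Gamma> j t))" if "t \<in> {0<..<1}" for t
    using branch(3)[of "\<Gamma> j t"] L(2) inU[OF that] that unfolding arc_interior_def by auto
  have "weighted_arc A B (\<Gamma> j) w T"
  proof
    show "finite T" by fact
    show "continuous_on {0<..<1} (\<Gamma> j)" by fact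
    show "continuous_on ({0<..<1} - T) (\<lambda>t. vector_derivative (\<Gamma> j) (at t))"
      using arc_locally_analytic(2)[OF T pieces] by (intro continuous_at_imp_continuous_on) blast
    show "poly A (\<Gamma> j t) \<noteq> 0" if "t \<in> {0<..<1}" for t
      using disj that unfolding arc_interior_def by blast
    have "continuous_on U L" using L(1) by (meson DERIV_isCont continuous_at_imp_continuous_on)
    then have "continuous_on {0<..<1} (\<lambda>t. c * exp (L (\<Gamma> j t)))"
      using inU by (intro continuous_intros continuous_on_compose2[OF _ cont]) auto
    then show "continuous_on {0<..<1} (\<lambda>t. w (\<Gamma> j t))"
      by (rule continuous_on_eq) (simp add: w_eq)
    show "ends_in (\<Gamma> j) F (zeros A)" if "is_end F" for F
      using that ends unfolding is_end_def by auto
    fix t assume t: "t \<in> {0<..<1} - T"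
    show der: "(\<Gamma> j has_vector_derivative vector_derivative (\<Gamma> j) (at t)) (at t)"
      by (rule arc_locally_analytic(1)[OF T pieces t])
    have "((\<lambda>z. c * exp (L z)) has_field_derivative c * (exp (L (\<Gamma> j t)) * (poly B (\<Gamma> j t) / poly A (\<Gamma> j t)))) (at (\<Gamma> j t))"
      using L(1)[OF inU] t by (auto intro!: derivative_eq_intros)
    from field_vector_diff_chain_at[OF der this]
    have "((\<lambda>t. c * exp (L (\<Gamma> j t))) has_vector_derivative
        w (\<Gamma> j t) * poly B (\<Gamma> j t) / poly A (\<Gamma> j t) * vector_derivative (\<Gamma> j) (at t)) (at t)"
      using w_eq[of t] t by (simp add: o_def mult_ac)
    then show "((\<lambda>t. w (\<Gamma> j t)) has_vector_derivative
        w (\<Gamma> j t) * poly B (\<Gamma> j t) / poly A (\<Gamma> j t) * vector_derivative (\<Gamma> j) (at t)) (at t)"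
      using t w_eq by (elim has_vector_derivative_transform_within_open[of _ _ _ "{0<..<1}"]) auto
  qed (rule moments)
  then show ?thesis by (rule that)
qed

definition support :: "complex set" where
  "support = (\<Union>j<k. arc_trace (\<Gamma> j))"

lemma arc_separation:
  assumes "j < k" "z \<notin> support"
  obtains T \<epsilon> where "weighted_arc A B (\<Gamma> j) w T" "\<epsilon> > 0"
    "\<And>t. t \<in> {0<..<1} \<Longrightarrow> \<epsilon> \<le> cmod (\<Gamma> j t - z)"
proof -
  obtain T where T: "weighted_arc A B (\<Gamma> j) w T" using exists_weighted_arc[OF assms(1)] .
  then interpret weighted_arc A B "\<Gamma> j" w T .
  have "z \<notin> arc_trace (\<Gamma> j)" using assms unfolding support_def by auto
  then show ?thesis using that[OF T] positive_distance_to_arc[OF cont_arc ends] by metis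
qed

lemma closed_support: "closed support"
  unfolding support_def
proof (intro closed_UN ballI)
  fix j assume "j \<in> {..<k}"
  then obtain T where T: "weighted_arc A B (\<Gamma> j) w T" using exists_weighted_arc by auto
  then interpret weighted_arc A B "\<Gamma> j" w T .
  show "closed (arc_trace (\<Gamma> j))" by (rule closed_arc_trace[OF cont_arc ends])
qed auto

text \<open>
  This is what makes the electrostatic partner unique: two polynomials that agree off the support are
  equal.
\<close>

lemma infinite_complement_support: "infinite (- support)"
proof
  assume "finite (- support)"
  moreover have "negligible support"
    using semiclassical unfolding support_def semiclassical_weight_def
    by (intro negligible_Union) (auto intro: negligible_arc_trace)
  ultimately have "negligible (- support \<union> support)" using negligible_Un negligible_finite by blast
  then show False by simp
qed

definition moment :: "complex poly \<Rightarrow> complex" where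
  "moment p = (\<Sum>j<k. contour_integral (\<Gamma> j) (\<lambda>t. poly p t * w t))"

lemma moment_integrable:
  assumes "j < k"
  shows "(\<lambda>t. poly p t * w t) contour_integrable_on \<Gamma> j"
  using exists_weighted_arc[OF assms] weighted_arc.contour_integrable_poly by metis

lemma moment_add: "moment (p + q) = moment p + moment q"
  unfolding moment_def sum.distrib[symmetric]
  by (intro sum.cong refl) (simp add: distrib_right contour_integral_add moment_integrable)

lemma moment_smult: "moment (smult c p) = c * moment p"
  unfolding moment_def sum_distrib_left
  by (intro sum.cong refl) (simp add: mult.assoc contour_integral_lmul moment_integrable)

definition cauchy :: "complex poly \<Rightarrow> complex \<Rightarrow> complex" where
  "cauchy p = cauchy_transform k \<Gamma> w (poly p)"

lemma cauchy_derivative: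
  assumes "z \<notin> support"
  shows "(cauchy p has_field_derivative
            (\<Sum>j<k. contour_integral (\<Gamma> j) (\<lambda>x. poly p x / (x - z)^2 * w x))) (at z)"
proof -
  have "((\<lambda>z. contour_integral (\<Gamma> j) (\<lambda>x. poly p x * w x / (x - z))) has_field_derivative
            contour_integral (\<Gamma> j) (\<lambda>x. poly p x / (x - z)^2 * w x)) (at z)" if j: "j < k" for j
  proof -
    obtain T \<epsilon> where T: "weighted_arc A B (\<Gamma> j) w T" and \<epsilon>: "\<epsilon> > 0"
      "\<And>t. t \<in> {0<..<1} \<Longrightarrow> \<epsilon> \<le> cmod (\<Gamma> j t - z)" by (rule arc_separation[OF j assms]) blast
    show ?thesis by (rule weighted_arc.cauchy_kernel_derivative[OF T \<epsilon>])
  qed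
  then show ?thesis
    unfolding cauchy_def cauchy_transform_def by (intro DERIV_sum) auto
qed

lemma cauchy_has_deriv:
  assumes "z \<notin> support"
  shows "(cauchy p has_field_derivative deriv (cauchy p) z) (at z)"
  using cauchy_derivative[OF assms, of p] DERIV_imp_deriv[OF cauchy_derivative[OF assms, of p]] by simp

text \<open>
  This comes from \<open>(x - \<zeta>) / (x - z) = 1 + (z - \<zeta>) / (x - z)\<close>.
\<close>

lemma cauchy_linear_factor:
  assumes "z \<notin> support"
  shows "cauchy ([:-\<zeta>, 1:] * p) z = moment p + (z - \<zeta>) * cauchy p z"
proof -
  have "contour_integral (\<Gamma> j) (\<lambda>x. poly ([:-\<zeta>, 1:] * p) x * w x / (x - z)) =
      contour_integral (\<Gamma> j) (\<lambda>x. poly p x * w x) +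
      (z - \<zeta>) * contour_integral (\<Gamma> j) (\<lambda>x. poly p x * w x / (x - z))" if j: "j < k" for j
  proof -
    obtain T \<epsilon> where T: "weighted_arc A B (\<Gamma> j) w T" and \<epsilon>: "\<epsilon> > 0"
      "\<And>t. t \<in> {0<..<1} \<Longrightarrow> \<epsilon> \<le> cmod (\<Gamma> j t - z)" by (rule arc_separation[OF j assms]) blast
    interpret weighted_arc A B "\<Gamma> j" w T by fact
    have int: "(\<lambda>x. poly p x * w x / (x - z)) contour_integrable_on \<Gamma> j"
      using contour_integrable_poly_div_power[OF \<epsilon>, of p 1] by (simp add: mult.commute)
    have "contour_integral (\<Gamma> j) (\<lambda>x. poly ([:-\<zeta>, 1:] * p) x * w x / (x - z)) =
        contour_integral (\<Gamma> j) (\<lambda>x. poly p x * w x + (z - \<zeta>) * (poly p x * w x / (x - z)))"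
    proof (rule contour_integral_cong_arc)
      fix t :: real assume "t \<in> {0<..<1}"
      then have "\<Gamma> j t - z \<noteq> 0" using \<epsilon> by force
      then show "poly ([:-\<zeta>, 1:] * p) (\<Gamma> j t) * w (\<Gamma> j t) / (\<Gamma> j t - z) =
          poly p (\<Gamma> j t) * w (\<Gamma> j t) + (z - \<zeta>) * (poly p (\<Gamma> j t) * w (\<Gamma> j t) / (\<Gamma> j t - z))"
        by (simp add: field_simps)
    qed
    then show ?thesis
      by (simp only: contour_integral_add contour_integral_lmul contour_integrable_lmul int contour_integrable_poly)
  qed
  then show ?thesis
    unfolding cauchy_def cauchy_transform_def moment_def by (simp add: sum.distrib sum_distrib_left)
qed

lemma cauchy_smult:
  assumes "z \<notin> support"
  shows "cauchy (smult c p) z = c * cauchy p z"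
proof -
  have "contour_integral (\<Gamma> j) (\<lambda>x. poly (smult c p) x * w x / (x - z)) =
      c * contour_integral (\<Gamma> j) (\<lambda>x. poly p x * w x / (x - z))" if j: "j < k" for j
  proof -
    obtain T \<epsilon> where T: "weighted_arc A B (\<Gamma> j) w T" and \<epsilon>: "\<epsilon> > 0"
      "\<And>t. t \<in> {0<..<1} \<Longrightarrow> \<epsilon> \<le> cmod (\<Gamma> j t - z)" by (rule arc_separation[OF j assms]) blast
    interpret weighted_arc A B "\<Gamma> j" w T by fact
    have "(\<lambda>x. poly p x * w x / (x - z)) contour_integrable_on \<Gamma> j"
      using contour_integrable_poly_div_power[OF \<epsilon>, of p 1] by (simp add: mult.commute)
    from contour_integral_lmul[OF this, of c] show ?thesis by (simp add: mult.assoc)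
  qed
  then show ?thesis
    unfolding cauchy_def cauchy_transform_def by (simp add: sum_distrib_left)
qed

text \<open>
  The Cauchy transform of 1 solves an inhomogeneous first-order equation whose right-hand side is a
  polynomial in \<open>z\<close>; this is the only place where the behaviour of the weight at the ends of the arcs
  enters.
\<close>

lemma cauchy_equation:
  assumes z: "z \<notin> support"
  shows "poly A z * deriv (cauchy 1) z - poly B z * cauchy 1 z =
      moment (synthetic_div (pderiv A + B) z) - moment (synthetic_div (synthetic_div A z) z)"
proof -
  have "poly A z * contour_integral (\<Gamma> j) (\<lambda>x. poly 1 x / (x - z)^2 * w x)
      - poly B z * contour_integral (\<Gamma> j) (\<lambda>x. poly 1 x * w x / (x - z)) =
      contour_integral (\<Gamma> j) (\<lambda>x. poly (synthetic_div (pderiv A + B) z) x * w x)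
      - contour_integral (\<Gamma> j) (\<lambda>x. poly (synthetic_div (synthetic_div A z) z) x * w x)" (is "?L = ?R")
    if j: "j < k" for j
  proof -
    obtain T \<epsilon> where T: "weighted_arc A B (\<Gamma> j) w T" and \<epsilon>: "\<epsilon> > 0"
      "\<And>t. t \<in> {0<..<1} \<Longrightarrow> \<epsilon> \<le> cmod (\<Gamma> j t - z)" by (rule arc_separation[OF j z]) blast
    interpret weighted_arc A B "\<Gamma> j" w T by fact
    define g where "g x = (poly (pderiv A + B) x / (x - z) - poly A x / (x - z)^2) * w x" for x
    have g: "(g has_contour_integral 0) (\<Gamma> j)"
      unfolding g_def by (rule pearson_cauchy_kernel[OF \<epsilon>])
    have int1: "(\<lambda>x. poly 1 x * w x / (x - z)) contour_integrable_on \<Gamma> j"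
      using contour_integrable_poly_div_power[OF \<epsilon>, of 1 1] by simp
    note int2 = contour_integrable_poly_div_power[OF \<epsilon>, of 1 2]
    have "?L = contour_integral (\<Gamma> j) (\<lambda>x. poly A z * (poly 1 x / (x - z)^2 * w x)
        - poly B z * (poly 1 x * w x / (x - z)))"
      by (simp only: contour_integral_diff contour_integral_lmul contour_integrable_lmul int1 int2)
    also have "\<dots> = contour_integral (\<Gamma> j) (\<lambda>x. poly (synthetic_div (pderiv A + B) z) x * w x
        - poly (synthetic_div (synthetic_div A z) z) x * w x - g x)"
    proof (rule contour_integral_cong_arc)
      fix t :: real assume "t \<in> {0<..<1}"
      then have "\<Gamma> j t \<noteq> z" using \<epsilon> by force
      from divided_difference_identity[OF this, of A B]
      have "(poly A z / (\<Gamma> j t - z)^2 - poly B z / (\<Gamma> j t - z)) * w (\<Gamma> j t) =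
        (poly (synthetic_div (pderiv A + B) z) (\<Gamma> j t) - poly (synthetic_div (synthetic_div A z) z) (\<Gamma> j t)
         - (poly (pderiv A + B) (\<Gamma> j t) / (\<Gamma> j t - z) - poly A (\<Gamma> j t) / (\<Gamma> j t - z)^2)) * w (\<Gamma> j t)"
        by (rule arg_cong)
      then show "poly A z * (poly 1 (\<Gamma> j t) / (\<Gamma> j t - z)^2 * w (\<Gamma> j t))
          - poly B z * (poly 1 (\<Gamma> j t) * w (\<Gamma> j t) / (\<Gamma> j t - z)) =
          poly (synthetic_div (pderiv A + B) z) (\<Gamma> j t) * w (\<Gamma> j t)
          - poly (synthetic_div (synthetic_div A z) z) (\<Gamma> j t) * w (\<Gamma> j t) - g (\<Gamma> j t)"
        unfolding g_def by (simp add: left_diff_distrib)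
    qed
    also have "\<dots> = ?R - contour_integral (\<Gamma> j) g"
      using g by (simp only: contour_integral_diff contour_integrable_diff contour_integrable_poly
          has_contour_integral_integrable)
    finally show ?thesis using contour_integral_unique[OF g] by simp
  qed
  then show ?thesis
    using DERIV_imp_deriv[OF cauchy_derivative[OF z, of 1]]
    unfolding cauchy_def cauchy_transform_def moment_def
    by (simp only: sum_distrib_left sum_subtractf[symmetric]) (intro sum.cong refl, simp)
qed

lemma partner_det_eq:
  "partner_det A B k \<Gamma> w P z =
     poly P z * (poly A z * deriv (cauchy P) z - poly B z * cauchy P z)
     - poly A z * poly (pderiv P) z * cauchy P z"
  unfolding partner_det_def cauchy_def by (simp add: det_2 Let_def mult_ac)

lemma partner_det_smult:
  assumes "z \<notin> support"
  shows "partner_det A B k \<Gamma> w (smult c P) z = c^2 * partner_det A B k \<Gamma> w P z"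
proof -
  have "(cauchy (smult c P) has_field_derivative c * deriv (cauchy P) z) (at z)"
  proof (rule has_field_derivative_transform_within_open)
    show "((\<lambda>z. c * cauchy P z) has_field_derivative c * deriv (cauchy P) z) (at z)"
      by (intro DERIV_cmult cauchy_has_deriv assms)
    show "open (- support)" using closed_support by auto
  qed (use assms cauchy_smult in auto)
  then show ?thesis
    using assms unfolding partner_det_eq
    by (simp add: DERIV_imp_deriv cauchy_smult pderiv_smult power2_eq_square algebra_simps)
qed

text \<open>
  How the determinant changes when a linear factor is added. Every Cauchy transform on the right-hand
  side is hidden in the determinant of \<open>p\<close>, which carries the factor \<open>(z - \<zeta>)\<^sup>2\<close>. The remaining terms
  are polynomials, and they alone determine the value and the first derivative at \<open>\<zeta>\<close>.
\<close>

lemma partner_det_linear_factor: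
  assumes "z \<notin> support"
  shows "partner_det A B k \<Gamma> w ([:-\<zeta>, 1:] * p) z = (z - \<zeta>)^2 * partner_det A B k \<Gamma> w p z
     - moment p * (poly A z * poly p z
         + (z - \<zeta>) * (poly A z * poly (pderiv p) z + poly B z * poly p z))"
proof -
  have "(cauchy ([:-\<zeta>, 1:] * p) has_field_derivative cauchy p z + (z - \<zeta>) * deriv (cauchy p) z) (at z)"
  proof (rule has_field_derivative_transform_within_open)
    note cauchy_has_deriv[OF assms, of p]
    then show "((\<lambda>z. moment p + (z - \<zeta>) * cauchy p z) has_field_derivative
        cauchy p z + (z - \<zeta>) * deriv (cauchy p) z) (at z)"
      by (auto intro!: derivative_eq_intros)
    show "open (- support)" using closed_support by auto
  qed (use assms cauchy_linear_factor in auto)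
  then have d: "deriv (cauchy ([:-\<zeta>, 1:] * p)) z = cauchy p z + (z - \<zeta>) * deriv (cauchy p) z"
    by (rule DERIV_imp_deriv)
  have q: "poly ([:-\<zeta>, 1:] * p) z = (z - \<zeta>) * poly p z"
      "poly (pderiv ([:-\<zeta>, 1:] * p)) z = poly p z + (z - \<zeta>) * poly (pderiv p) z"
    by (simp add: algebra_simps) (simp only: pderiv_mult, simp add: pderiv_pCons algebra_simps)
  show ?thesis
    unfolding partner_det_eq d q cauchy_linear_factor[OF assms]
    by (simp add: power2_eq_square algebra_simps)
qed

text \<open>
  Splitting off the roots of \<open>P\<close> one at a time leads to a constant polynomial, where the claim is
  the first-order equation of the Cauchy transform of 1.
\<close>

lemma partner_det_polynomial:
  "\<exists>S. \<forall>z. z \<notin> support \<longrightarrow> poly S z = partner_det A B k \<Gamma> w P z"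
proof (induction "degree P" arbitrary: P)
  case 0
  then obtain c where P: "P = [:c:]" by (metis degree_eq_zeroE)
  obtain D1 D2 where D: "\<And>z. poly D1 z = moment (synthetic_div (pderiv A + B) z)"
      "\<And>z. poly D2 z = moment (synthetic_div (synthetic_div A z) z)"
    using functional_synthetic_div[of moment] functional_synthetic_div_twice[of moment]
      moment_add moment_smult by metis
  have "poly (smult (c^2) (D1 - D2)) z = partner_det A B k \<Gamma> w P z" if z: "z \<notin> support" for z
  proof -
    have "partner_det A B k \<Gamma> w P z = c^2 * partner_det A B k \<Gamma> w 1 z"
      using partner_det_smult[OF z, of c 1] by (simp add: P)
    also have "partner_det A B k \<Gamma> w 1 z = poly D1 z - poly D2 z"
      unfolding partner_det_eq D using cauchy_equation[OF z] by simp
    finally show ?thesis by simp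
  qed
  then show ?case by blast
next
  case (Suc n)
  then obtain \<zeta> where "poly P \<zeta> = 0" using alg_closed_imp_poly_has_root[of P] by auto
  then obtain p where P: "P = [:-\<zeta>, 1:] * p" by (auto simp: poly_eq_0_iff_dvd elim: dvdE)
  then have "p \<noteq> 0" using Suc(2) by auto
  then have "n = degree p" using Suc(2) unfolding P by (subst (asm) degree_mult_eq) auto
  from Suc(1)[OF this] obtain R where
    R: "\<And>z. z \<notin> support \<Longrightarrow> poly R z = partner_det A B k \<Gamma> w p z" by blast
  have "poly ([:-\<zeta>, 1:]^2 * R - smult (moment p) (A * p + [:-\<zeta>, 1:] * (A * pderiv p + B * p))) z
      = partner_det A B k \<Gamma> w P z" if "z \<notin> support" for z
    unfolding P partner_det_linear_factor[OF that] R[OF that, symmetric]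
    by (simp add: power2_eq_square algebra_simps)
  then show ?case by blast
qed

lemma poly_eq_off_support:
  assumes "\<And>z. z \<notin> support \<Longrightarrow> poly p z = poly q z"
  shows "p = q"
proof (rule ccontr)
  assume "p \<noteq> q"
  then have "finite {z. poly (p - q) z = 0}" by (intro poly_roots_finite) auto
  moreover have "- support \<subseteq> {z. poly (p - q) z = 0}" using assms by auto
  ultimately show False using infinite_complement_support finite_subset by blast
qed

lemma poly_electrostatic_partner:
  assumes "z \<notin> support"
  shows "poly (electrostatic_partner A B k \<Gamma> w P) z = partner_det A B k \<Gamma> w P z"
proof -
  have "\<exists>!S. \<forall>z. z \<notin> support \<longrightarrow> poly S z = partner_det A B k \<Gamma> w P z"
    using partner_det_polynomial poly_eq_off_support by metis
  from theI'[OF this] show ?thesis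
    using assms unfolding electrostatic_partner_def support_def by blast
qed

lemma electrostatic_partner_linear_factor:
  "electrostatic_partner A B k \<Gamma> w ([:-\<zeta>, 1:] * p) =
     [:-\<zeta>, 1:]^2 * electrostatic_partner A B k \<Gamma> w p
     - smult (moment p) (A * p + [:-\<zeta>, 1:] * (A * pderiv p + B * p))"
proof (rule poly_eq_off_support)
  fix z assume z: "z \<notin> support"
  show "poly (electrostatic_partner A B k \<Gamma> w ([:-\<zeta>, 1:] * p)) z =
      poly ([:-\<zeta>, 1:]^2 * electrostatic_partner A B k \<Gamma> w p
        - smult (moment p) (A * p + [:-\<zeta>, 1:] * (A * pderiv p + B * p))) z"
    unfolding poly_electrostatic_partner[OF z] partner_det_linear_factor[OF z]
    by (simp add: poly_electrostatic_partner[OF z] power2_eq_square algebra_simps)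
qed

text \<open>
  Modulo \<open>(z - \<zeta>)\<^sup>2\<close> the partner is a multiple of \<open>A p + (z - \<zeta>) (A p' + B p)\<close>, whose logarithmic
  derivative at \<open>\<zeta>\<close> is \<open>A'/A + 2 p'/p + B/A\<close>. As this is an identity between polynomials, \<open>\<zeta>\<close> may lie
  on the support of the weight.
\<close>

lemma log_derivative_at_zero:
  assumes S: "S = electrostatic_partner A B k \<Gamma> w ([:-\<zeta>, 1:] * p)"
    and nz: "poly S \<zeta> \<noteq> 0"
  shows "poly p \<zeta> \<noteq> 0"
    and "poly (pderiv S) \<zeta> / poly S \<zeta> - poly (pderiv A) \<zeta> / poly A \<zeta> - poly B \<zeta> / poly A \<zeta> =
           2 * (poly (pderiv p) \<zeta> / poly p \<zeta>)"
proof -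
  define R where "R = electrostatic_partner A B k \<Gamma> w p"
  have S_eq: "S = [:-\<zeta>, 1:] * ([:-\<zeta>, 1:] * R)
      - smult (moment p) (A * p + [:-\<zeta>, 1:] * (A * pderiv p + B * p))"
    unfolding S electrostatic_partner_linear_factor R_def by (simp only: power2_eq_square mult.assoc)
  have der: "poly (pderiv ([:-\<zeta>, 1:] * q)) \<zeta> = poly q \<zeta>" for q
    by (simp only: pderiv_mult) (simp add: pderiv_pCons)
  have S0: "poly S \<zeta> = - moment p * (poly A \<zeta> * poly p \<zeta>)"
    unfolding S_eq by simp
  have S1: "poly (pderiv S) \<zeta> = - moment p * (poly (pderiv A) \<zeta> * poly p \<zeta>
      + 2 * (poly A \<zeta> * poly (pderiv p) \<zeta>) + poly B \<zeta> * poly p \<zeta>)"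
    unfolding S_eq pderiv_diff poly_diff pderiv_smult pderiv_add poly_smult poly_add der
    by (simp add: pderiv_mult algebra_simps)
  show "poly p \<zeta> \<noteq> 0" using nz unfolding S0 by auto
  then show "poly (pderiv S) \<zeta> / poly S \<zeta> - poly (pderiv A) \<zeta> / poly A \<zeta> - poly B \<zeta> / poly A \<zeta> =
      2 * (poly (pderiv p) \<zeta> / poly p \<zeta>)"
    using nz unfolding S0 S1 by (simp add: field_simps)
qed

end

section \<open>The external field\<close>

lemma log_field_branch_exists:
  assumes "poly A p \<noteq> 0" "poly S p \<noteq> 0"
  shows "\<exists>U \<phi>. (U, \<phi>) \<in> log_field A B S \<and> p \<in> U"
proof -
  have "open {z. poly (A * S) z \<noteq> 0}" by (intro open_Collect_neq continuous_intros)
  moreover have "p \<in> {z. poly (A * S) z \<noteq> 0}" using assms by simp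
  ultimately obtain r where r: "r > 0" "ball p r \<subseteq> {z. poly (A * S) z \<noteq> 0}"
    using open_contains_ball by blast
  have nz: "poly A z \<noteq> 0" "poly S z \<noteq> 0" if "z \<in> ball p r" for z
    using r(2) that by auto
  have "(\<lambda>z. poly B z / poly A z) holomorphic_on ball p r"
    using nz by (intro holomorphic_intros) auto
  then obtain L where "\<And>z. z \<in> ball p r \<Longrightarrow>
      (L has_field_derivative poly B z / poly A z) (at z within ball p r)"
    using holomorphic_convex_primitive'[OF convex_ball open_ball] by blast
  then have L: "\<And>z. z \<in> ball p r \<Longrightarrow> (L has_field_derivative poly B z / poly A z) (at z)"
    using at_within_open[OF _ open_ball] by metis
  have "w_branch A B (ball p r) (\<lambda>z. exp (L z))"
    unfolding w_branch_def using nz L by (auto intro!: exI[of _ L])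
  then have "(ball p r, \<lambda>z. 1 / 2 * ln (cmod (poly S z / (poly A z * exp (L z))))) \<in> log_field A B S"
    unfolding log_field_def using nz by auto
  then show ?thesis using r(1) by (meson centre_in_ball)
qed

lemma singularities_log_field: "singularities (log_field A B S) = zeros A \<union> zeros S"
proof -
  have "p \<notin> zeros A \<union> zeros S" if "(U, \<phi>) \<in> log_field A B S" "p \<in> U" for U \<phi> p
    using that unfolding log_field_def w_branch_def by blast
  then show ?thesis
    unfolding singularities_def using log_field_branch_exists[of A _ S B] by fast
qed

text \<open>
  The single-valued derivative \<open>\<Phi>'\<close> of the complex potential of the field.
\<close>

definition field_derivative :: "complex poly \<Rightarrow> complex poly \<Rightarrow> complex poly \<Rightarrow> complex \<Rightarrow> complex" where
  "field_derivative A B S z =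
     (poly (pderiv S) z / poly S z - poly (pderiv A) z / poly A z - poly B z / poly A z) / 2"

text \<open>
  On a small disc \<open>S / A\<close> has a holomorphic logarithm \<open>g\<close>, and \<open>\<Phi> = (g - L) / 2\<close> with \<open>L\<close> a branch of
  \<open>\<integral> B/A\<close>.
\<close>

lemma log_field_local_potential:
  assumes "(U, \<phi>) \<in> log_field A B S" "p \<in> U"
  shows "\<exists>V \<Phi>. open V \<and> p \<in> V \<and> V \<subseteq> U \<and>
     (\<forall>z\<in>V. (\<Phi> has_field_derivative field_derivative A B S z) (at z) \<and> \<phi> z = Re (\<Phi> z))"
proof -
  obtain W where US: "U \<inter> zeros S = {}" and W: "w_branch A B U W"
    and \<phi>: "\<And>z. z \<in> U \<Longrightarrow> \<phi> z = 1 / 2 * ln (cmod (poly S z / (poly A z * W z)))"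
    using assms(1) unfolding log_field_def by auto
  obtain L where UA: "open U" "U \<inter> zeros A = {}"
    and L: "\<And>z. z \<in> U \<Longrightarrow> (L has_field_derivative poly B z / poly A z) (at z)" "\<And>z. z \<in> U \<Longrightarrow> W z = exp (L z)"
    using W unfolding w_branch_def by auto
  obtain r where r: "r > 0" "ball p r \<subseteq> U" using UA(1) assms(2) open_contains_ball by blast
  have nz: "poly A z \<noteq> 0" "poly S z \<noteq> 0" if "z \<in> ball p r" for z
    using r(2) that UA US by blast+
  have "(\<lambda>z. poly S z / poly A z) holomorphic_on ball p r"
    using nz by (intro holomorphic_intros) auto
  then obtain g where g: "g holomorphic_on ball p r" "\<And>z. z \<in> ball p r \<Longrightarrow> poly S z / poly A z = exp (g z)"
    using contractible_imp_holomorphic_log[of _ "ball p r"] nz convex_imp_contractible[OF convex_ball]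
    by (metis (no_types, lifting) divide_eq_0_iff)
  have "((\<lambda>z. (g z - L z) / 2) has_field_derivative field_derivative A B S z) (at z)"
    if z: "z \<in> ball p r" for z
  proof -
    have g': "(g has_field_derivative deriv g z) (at z)"
      using g(1) z by (intro holomorphic_derivI) auto
    have "((\<lambda>z. poly S z / poly A z) has_field_derivative
        (poly (pderiv S) z * poly A z - poly S z * poly (pderiv A) z) / (poly A z * poly A z)) (at z)"
      using nz[OF z] by (intro DERIV_divide poly_DERIV)
    moreover have "((\<lambda>z. poly S z / poly A z) has_field_derivative exp (g z) * deriv g z) (at z)"
    proof (rule has_field_derivative_transform_within_open[of _ _ _ "ball p r"])
      show "((\<lambda>z. exp (g z)) has_field_derivative exp (g z) * deriv g z) (at z)"
        using g' by (auto intro!: derivative_eq_intros)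
    qed (use z g(2) in auto)
    ultimately have "poly S z / poly A z * deriv g z =
        (poly (pderiv S) z * poly A z - poly S z * poly (pderiv A) z) / (poly A z * poly A z)"
      using DERIV_unique g(2)[OF z] by metis
    then have "deriv g z = poly (pderiv S) z / poly S z - poly (pderiv A) z / poly A z"
      using nz[OF z] by (simp add: field_simps)
    moreover have "((\<lambda>z. (g z - L z) / 2) has_field_derivative
        (deriv g z - poly B z / poly A z) / 2) (at z)"
      using r(2) z by (intro DERIV_cdivide DERIV_diff g' L(1)) auto
    ultimately show ?thesis by (simp only: field_derivative_def)
  qed
  moreover have "\<phi> z = Re ((g z - L z) / 2)" if z: "z \<in> ball p r" for z
  proof -
    have "cmod (poly S z / (poly A z * W z)) = exp (Re (g z) - Re (L z))"
    proof -
      have "poly S z / (poly A z * W z) = exp (g z) / exp (L z)"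
        using L(2)[of z] z r(2) unfolding g(2)[OF z, symmetric] by auto
      then show ?thesis by (simp add: norm_divide exp_diff)
    qed
    then show ?thesis using \<phi>[of z] z r(2) by auto
  qed
  ultimately show ?thesis using r by (intro exI[of _ "ball p r"] exI[of _ "\<lambda>z. (g z - L z) / 2"]) auto
qed

lemma external_field_log_field:
  assumes "A \<noteq> 0" "S \<noteq> 0"
  shows "external_field (log_field A B S)"
proof -
  have "field_derivative A B S holomorphic_on (- singularities (log_field A B S))"
    unfolding singularities_log_field field_derivative_def[abs_def] by (intro holomorphic_intros) auto
  moreover have "open U" if "(U, \<phi>) \<in> log_field A B S" for U \<phi>
    using that unfolding log_field_def w_branch_def by auto
  moreover have "finite (singularities (log_field A B S))"
    unfolding singularities_log_field using assms poly_roots_finite by auto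
  ultimately show ?thesis
    unfolding external_field_def using log_field_local_potential
    by (intro conjI exI[of _ "field_derivative A B S"]) auto
qed

lemma log_field_has_derivative:
  assumes "(U, \<phi>) \<in> log_field A B S" "p \<in> U"
  shows "(\<phi> has_derivative (\<lambda>h. Re (h * field_derivative A B S p))) (at p)"
proof -
  obtain V \<Phi> where V: "open V" "p \<in> V"
    and \<Phi>: "\<And>z. z \<in> V \<Longrightarrow> (\<Phi> has_field_derivative field_derivative A B S z) (at z)"
      "\<And>z. z \<in> V \<Longrightarrow> \<phi> z = Re (\<Phi> z)"
    using log_field_local_potential[OF assms] by blast
  have "(\<Phi> has_derivative (\<lambda>h. h * field_derivative A B S p)) (at p)"
    using \<Phi>(1)[OF V(2)] by (simp add: has_field_derivative_def mult.commute[of _ "field_derivative A B S p"])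
  then have "((\<lambda>z. Re (\<Phi> z)) has_derivative (\<lambda>h. Re (h * field_derivative A B S p))) (at p)"
    by (rule has_derivative_Re)
  then show ?thesis
    by (rule has_derivative_transform_within_open[OF _ V]) (simp add: \<Phi>)
qed

section \<open>The gradient of the discrete energy\<close>

text \<open>
  The point \<open>\<zeta> k\<close> meets every other point in two ordered pairs, which yields the factor 2 common
  to the interaction and the field.
\<close>

lemma discrete_energy_has_derivative:
  assumes inj: "inj_on \<zeta> {..<N}" and k: "k < N"
    and \<psi>: "(\<psi> k has_derivative (\<lambda>h. Re (h * d))) (at (\<zeta> k))"
  shows "((\<lambda>z. discrete_energy N \<psi> (\<zeta>(k := z))) has_derivative
           (\<lambda>h. 2 * Re (h * (d - (\<Sum>j\<in>{..<N} - {k}. 1 / (\<zeta> k - \<zeta> j)))))) (at (\<zeta> k))"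
proof -
  define \<delta> where "\<delta> i j h = (if i = k then - Re (h / (\<zeta> k - \<zeta> j))
      else if j = k then - Re (h / (\<zeta> k - \<zeta> i)) else 0)" for i j h
  have log: "((\<lambda>z. ln (1 / cmod (z - a))) has_derivative (\<lambda>h. - Re (h / (z - a)))) (at z)"
    if "z \<noteq> a" for z a
  proof -
    have "((\<lambda>z. z - a) has_derivative (\<lambda>h. h)) (at z)" by (auto intro!: derivative_eq_intros)
    moreover have "z - a \<noteq> 0" using that by simp
    ultimately have "((\<lambda>z. ln (cmod (z - a))) has_derivative (\<lambda>h. Re (h / (z - a)))) (at z)"
      using has_derivative_compose[OF _ has_derivative_ln_cmod] by blast
    moreover have "(\<lambda>z. ln (1 / cmod (z - a))) = (\<lambda>z. - ln (cmod (z - a)))"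
      by (simp add: fun_eq_iff ln_div)
    ultimately show ?thesis by (simp add: has_derivative_minus)
  qed
  have pair: "((\<lambda>z. ln (1 / cmod ((\<zeta>(k := z)) i - (\<zeta>(k := z)) j))) has_derivative \<delta> i j) (at (\<zeta> k))"
    if ij: "i < N" "j < N" "i \<noteq> j" for i j
  proof -
    have ne: "\<zeta> k \<noteq> \<zeta> l" if "l < N" "l \<noteq> k" for l
      using inj that k by (metis inj_onD lessThan_iff)
    consider "i = k" "j \<noteq> k" | "j = k" "i \<noteq> k" | "i \<noteq> k" "j \<noteq> k" using ij by auto
    then show ?thesis
    proof cases
      case 1
      then show ?thesis using log[OF ne[of j]] ij by (simp add: \<delta>_def[abs_def])
    next
      case 2
      then show ?thesis using log[OF ne[of i]] ij
        by (simp add: \<delta>_def[abs_def] norm_minus_commute[of "\<zeta> i"])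
    qed (simp add: \<delta>_def[abs_def])
  qed
  have field: "((\<lambda>z. \<psi> i ((\<zeta>(k := z)) i)) has_derivative (\<lambda>h. if i = k then Re (h * d) else 0)) (at (\<zeta> k))" for i
    using \<psi> by (cases "i = k") auto
  have "((\<lambda>z. discrete_energy N \<psi> (\<zeta>(k := z))) has_derivative
      (\<lambda>h. (\<Sum>i<N. \<Sum>j\<in>{..<N} - {i}. \<delta> i j h) + 2 * (\<Sum>i<N. if i = k then Re (h * d) else 0))) (at (\<zeta> k))"
    unfolding discrete_energy_def
    by (intro has_derivative_add has_derivative_sum has_derivative_mult_right pair field) auto
  moreover have "(\<Sum>i<N. \<Sum>j\<in>{..<N} - {i}. \<delta> i j h) + 2 * (\<Sum>i<N. if i = k then Re (h * d) else 0) =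
      2 * Re (h * (d - (\<Sum>j\<in>{..<N} - {k}. 1 / (\<zeta> k - \<zeta> j))))" for h
  proof -
    have row: "(\<Sum>j\<in>{..<N} - {k}. \<delta> k j h) = - (\<Sum>j\<in>{..<N} - {k}. Re (h / (\<zeta> k - \<zeta> j)))"
      by (simp add: \<delta>_def sum_negf)
    have col: "(\<Sum>j\<in>{..<N} - {i}. \<delta> i j h) = - Re (h / (\<zeta> k - \<zeta> i))" if "i \<in> {..<N} - {k}" for i
    proof -
      have "(\<Sum>j\<in>{..<N} - {i}. \<delta> i j h) = (\<Sum>j\<in>{..<N} - {i}. if j = k then - Re (h / (\<zeta> k - \<zeta> i)) else 0)"
        using that by (intro sum.cong) (auto simp: \<delta>_def)
      then show ?thesis using that k by auto
    qed
    have "(\<Sum>i<N. \<Sum>j\<in>{..<N} - {i}. \<delta> i j h) =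
        (\<Sum>j\<in>{..<N} - {k}. \<delta> k j h) + (\<Sum>i\<in>{..<N} - {k}. \<Sum>j\<in>{..<N} - {i}. \<delta> i j h)"
      using k by (intro sum.remove) auto
    also have "\<dots> = - 2 * (\<Sum>j\<in>{..<N} - {k}. Re (h / (\<zeta> k - \<zeta> j)))"
      using col by (simp add: row sum_negf)
    also have "(\<Sum>j\<in>{..<N} - {k}. Re (h / (\<zeta> k - \<zeta> j))) = Re (h * (\<Sum>j\<in>{..<N} - {k}. 1 / (\<zeta> k - \<zeta> j)))"
      by (simp only: sum_distrib_left Re_sum times_divide_eq_right mult_1_right)
    finally show ?thesis using k by (simp add: right_diff_distrib)
  qed
  ultimately show ?thesis by simp
qed

lemma log_derivative_prod_linear:
  fixes \<zeta> :: "'a \<Rightarrow> complex"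
  assumes "finite J" and "\<And>j. j \<in> J \<Longrightarrow> x \<noteq> \<zeta> j"
  shows "poly (pderiv (\<Prod>j\<in>J. [:- \<zeta> j, 1:])) x / poly (\<Prod>j\<in>J. [:- \<zeta> j, 1:]) x = (\<Sum>j\<in>J. 1 / (x - \<zeta> j))"
  using assms
proof (induction J rule: finite_induct)
  case (insert i J)
  define q where "q = (\<Prod>j\<in>J. [:- \<zeta> j, 1:])"
  have "poly q x \<noteq> 0" unfolding q_def poly_prod using insert by (auto simp: prod_zero_iff)
  moreover have "x - \<zeta> i \<noteq> 0" using insert by auto
  ultimately have "poly (pderiv ([:- \<zeta> i, 1:] * q)) x / poly ([:- \<zeta> i, 1:] * q) x =
      1 / (x - \<zeta> i) + poly (pderiv q) x / poly q x"
    by (simp add: pderiv_mult pderiv_pCons divide_simps del: mult_pCons_left)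
  also have "poly (pderiv q) x / poly q x = (\<Sum>j\<in>J. 1 / (x - \<zeta> j))"
    unfolding q_def using insert by auto
  finally show ?case
    unfolding q_def prod.insert[OF insert(1,2)] sum.insert[OF insert(1,2)] .
qed simp

theorem proposition3p9:
  fixes A B P S :: "complex poly"
    and \<Gamma> :: "nat \<Rightarrow> real \<Rightarrow> complex"
    and w :: "complex \<Rightarrow> complex"
    and k N :: nat
  assumes "semiclassical_weight A B k \<Gamma> w"
    and "P \<noteq> 0" and "degree P = N"
    and "S = electrostatic_partner A B k \<Gamma> w P"
    and "\<forall>z. poly (A * S) z = 0 \<longrightarrow> poly P z \<noteq> 0"
  shows "(S \<noteq> 0 \<longrightarrow> external_field (log_field A B S)) \<and>
         critical_measure (log_field A B S) (zero_counting_measure P)"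
proof
  interpret semiclassical A B k \<Gamma> w by unfold_locales fact
  have "A \<noteq> 0" using assms(1) unfolding semiclassical_weight_def by auto
  then show "S \<noteq> 0 \<longrightarrow> external_field (log_field A B S)" using external_field_log_field by blast
  obtain \<zeta> where "smult (lead_coeff P) (\<Prod>i<N. [:- \<zeta> i, 1:]) = P"
    using complex_poly_decompose'[of P] assms(3) by metis
  then have P: "P = smult (lead_coeff P) (\<Prod>i<N. [:- \<zeta> i, 1:])" by simp
  define c where "c = lead_coeff P"
  have "c \<noteq> 0" using assms(2) by (simp add: c_def)
  define p where "p i = smult c (\<Prod>j\<in>{..<N} - {i}. [:- \<zeta> j, 1:])" for i
  have P_factor: "P = [:- \<zeta> i, 1:] * p i" if "i < N" for i
    unfolding p_def c_def using that by (subst P, subst prod.remove[of _ i]) auto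
  have AS: "poly A (\<zeta> i) \<noteq> 0" "poly S (\<zeta> i) \<noteq> 0" if "i < N" for i
  proof -
    have "poly P (\<zeta> i) = 0" by (subst P_factor[OF that]) simp
    then show "poly A (\<zeta> i) \<noteq> 0" "poly S (\<zeta> i) \<noteq> 0" using assms(5) by auto
  qed
  have key: "poly (p i) (\<zeta> i) \<noteq> 0"
      "field_derivative A B S (\<zeta> i) = poly (pderiv (p i)) (\<zeta> i) / poly (p i) (\<zeta> i)" if "i < N" for i
  proof -
    have "S = electrostatic_partner A B k \<Gamma> w ([:- \<zeta> i, 1:] * p i)"
      using assms(4) P_factor[OF that] by simp
    from log_derivative_at_zero[OF this AS(2)[OF that]]
    show "poly (p i) (\<zeta> i) \<noteq> 0"
      "field_derivative A B S (\<zeta> i) = poly (pderiv (p i)) (\<zeta> i) / poly (p i) (\<zeta> i)"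
      unfolding field_derivative_def by simp_all
  qed
  \<comment> \<open>The cofactor \<open>p i\<close> does not vanish at \<open>\<zeta> i\<close>, so the zeros of \<open>P\<close> are simple.\<close>
  have ne: "\<zeta> i \<noteq> \<zeta> j" if "i < N" "j \<in> {..<N} - {i}" for i j
    using key(1)[OF that(1)] that unfolding p_def by (auto simp: poly_prod)
  have inj: "inj_on \<zeta> {..<N}" using ne by (auto simp: inj_on_def)
  have critical: "field_derivative A B S (\<zeta> i) = (\<Sum>j\<in>{..<N} - {i}. 1 / (\<zeta> i - \<zeta> j))" if "i < N" for i
    using key(2)[OF that] log_derivative_prod_linear[of "{..<N} - {i}" "\<zeta> i" \<zeta>] ne[OF that] \<open>c \<noteq> 0\<close>
    unfolding p_def by (simp add: pderiv_smult)
  have "proots P = (\<Sum>i<N. {#\<zeta> i#})"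
    using \<open>c \<noteq> 0\<close> by (subst P) (simp add: c_def[symmetric] proots_prod)
  also have "\<dots> = image_mset \<zeta> (mset_set {..<N})"
    by (induction N) (simp_all add: lessThan_Suc)
  finally have measure: "zero_counting_measure P = dirac_sum (image_mset \<zeta> (mset_set {..<N}))"
    unfolding zero_counting_measure_def by simp
  show "critical_measure (log_field A B S) (zero_counting_measure P)"
    unfolding critical_measure_def
  proof (intro exI conjI allI impI)
    show "\<zeta> ` {..<N} \<inter> singularities (log_field A B S) = {}"
      unfolding singularities_log_field using AS by auto
    fix U \<psi> i
    assume "\<forall>k<N. (U k, \<psi> k) \<in> log_field A B S \<and> \<zeta> k \<in> U k" "i < N"
    then have "(\<psi> i has_derivative (\<lambda>h. Re (h * field_derivative A B S (\<zeta> i)))) (at (\<zeta> i))"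
      using log_field_has_derivative by blast
    from discrete_energy_has_derivative[of \<zeta> N i \<psi>, OF inj \<open>i < N\<close> this]
    show "((\<lambda>z. discrete_energy N \<psi> (\<zeta>(i := z))) has_derivative (\<lambda>_. 0)) (at (\<zeta> i))"
      using critical[OF \<open>i < N\<close>] by simp
  qed (fact inj measure)+
qed

end
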